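(* Let $R$ be a ring and let $M$ be an $AB5^*$ right $R$-module which has Noetherian dimension. The following statements are equivalent. (1) $M\in\mathcal A$. (2) $n\text{-}\dim M$ is a limit ordinal, or $n\text{-}\dim A\le n\text{-}\dim(M/A)$ for every atomic submodule $A$ of $M$.
   Context: Rings are associative with identity and modules are unital right modules. Ordinals are taken to begin with $-1$; thus $0$ is the successor of $-1$ and neither $-1$ nor $0$ is regarded as a limit ordinal. Noetherian dimension (also called dual Krull dimension) $n\text{-}\dim M$: defined by transfinite recursion. $n\text{-}\dim M=-1$ iff $M=0$. For an ordinal $\alpha\ge 0$, $n\text{-}\dim M=\alpha$ iff $n\text{-}\dim M\not<\alpha$ and for every ascending chain $M_0\subseteq M_1\subseteq M_2\subseteq\cdots$ of submodules of $M$ there is $k$ with $n\text{-}\dim(M_{i+1}/M_i)<\alpha$ for all $i\ge k$. If no such ordinal exists, $M$ does not have Noetherian dimension. A module $M$ is an $AB5^*$ module if for every submodule $B$ of $M$ and every inverse system (i.e. downward directed family) $\{A_i\}_{i\in I}$ of submodules of $M$, $B+\bigcap_{i\in I}A_i=\bigcap_{i\in I}(B+A_i)$. A module $M$ is $\alpha$-short if for every submodule $N$ of $M$ either $n\text{-}\dim N\le\alpha$ or $n\text{-}\dim(M/N)\le\alpha$, and $\alpha$ is the least ordinal with this property. (It is known that an $\alpha$-short module has Noetherian dimension $\alpha$ or $\alpha+1$.) $\mathcal A_\alpha$ is the class of $\alpha$-short modules $M$ with $n\text{-}\dim M=\alpha$, and $\mathcal A=\bigcup_\alpha\mathcal A_\alpha$.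 A module $A$ is $\alpha$-atomic if $A\ne0$, $n\text{-}\dim A=\alpha$ and $n\text{-}\dim N<\alpha$ for every proper submodule $N$ of $A$; $A$ is atomic if it is $\alpha$-atomic for some ordinal $\alpha$. *)

theory Defs
  imports "HOL-Algebra.Module" "HOL-Algebra.AbelCoset"
begin

section \<open>Right modules over a (not necessarily commutative) ring\<close>

text \<open>
  The records and the predicate \<^const>\<open>submodule\<close> are those of HOL-Algebra.  The right action
  \<open>x \<cdot> r\<close> is stored in the field \<^const>\<open>smult\<close> and hence written \<open>r \<odot>\<^bsub>M\<^esub> x\<close>; what makes it a
  \<^emph>\<open>right\<close> action is \<open>smult_assoc\<close>, which says \<open>x \<cdot> (a b) = (x \<cdot> a) \<cdot> b\<close>.
  As in HOL-Algebra, the multiplicative fields of the module record are meaningless.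
\<close>

locale right_module = R?: ring R + M?: abelian_group M
  for R :: "('r, 'x) ring_scheme" (structure) and M :: "('r, 'm, 'y) module_scheme" (structure) +
  assumes smult_closed [simp, intro]:
      "\<lbrakk>a \<in> carrier R; x \<in> carrier M\<rbrakk> \<Longrightarrow> a \<odot>\<^bsub>M\<^esub> x \<in> carrier M"
    and smult_l_distr:
      "\<lbrakk>a \<in> carrier R; b \<in> carrier R; x \<in> carrier M\<rbrakk> \<Longrightarrow>
        (a \<oplus>\<^bsub>R\<^esub> b) \<odot>\<^bsub>M\<^esub> x = a \<odot>\<^bsub>M\<^esub> x \<oplus>\<^bsub>M\<^esub> b \<odot>\<^bsub>M\<^esub> x"
    and smult_r_distr:
      "\<lbrakk>a \<in> carrier R; x \<in> carrier M; y \<in> carrier M\<rbrakk> \<Longrightarrow>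
        a \<odot>\<^bsub>M\<^esub> (x \<oplus>\<^bsub>M\<^esub> y) = a \<odot>\<^bsub>M\<^esub> x \<oplus>\<^bsub>M\<^esub> a \<odot>\<^bsub>M\<^esub> y"
    and smult_assoc:
      "\<lbrakk>a \<in> carrier R; b \<in> carrier R; x \<in> carrier M\<rbrakk> \<Longrightarrow>
        (a \<otimes>\<^bsub>R\<^esub> b) \<odot>\<^bsub>M\<^esub> x = b \<odot>\<^bsub>M\<^esub> (a \<odot>\<^bsub>M\<^esub> x)"
    and smult_one [simp]:
      "x \<in> carrier M \<Longrightarrow> \<one>\<^bsub>R\<^esub> \<odot>\<^bsub>M\<^esub> x = x"

definition submod :: "('r, 'm) module \<Rightarrow> 'm set \<Rightarrow> ('r, 'm) module"
  where "submod M N = M\<lparr>carrier := N\<rparr>"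

text \<open>The factor module \<open>M/N\<close>, whose elements are the cosets of \<open>N\<close>.\<close>

definition factor_module :: "('r, 'm) module \<Rightarrow> 'm set \<Rightarrow> ('r, 'm set) module"
  where "factor_module M N =
    \<lparr>carrier = a_rcosets\<^bsub>M\<^esub> N, mult = undefined, one = undefined,
     zero = N, add = (<+>\<^bsub>M\<^esub>), smult = (\<lambda>r X. \<Union>x\<in>X. N +>\<^bsub>M\<^esub> (r \<odot>\<^bsub>M\<^esub> x))\<rparr>"

definition rmod_isomorphic ::
    "('r, 'x) ring_scheme \<Rightarrow> ('r, 'm) module \<Rightarrow> ('r, 'n) module \<Rightarrow> bool"
  where "rmod_isomorphic R M N \<longleftrightarrow>
    (\<exists>h. bij_betw h (carrier M) (carrier N) \<and>
      (\<forall>x\<in>carrier M. \<forall>y\<in>carrier M. h (x \<oplus>\<^bsub>M\<^esub> y) = h x \<oplus>\<^bsub>N\<^esub> h y) \<and>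
      (\<forall>r\<in>carrier R. \<forall>x\<in>carrier M. h (r \<odot>\<^bsub>M\<^esub> x) = r \<odot>\<^bsub>N\<^esub> h x))"


section \<open>Ordinals\<close>

text \<open>
  The ordinals \<open>-1, 0, 1, \<dots>\<close> are represented by the elements of a type
  \<open>'o :: {wellorder, order_bot}\<close>, with \<open>bot\<close> in the role of \<open>-1\<close>.  Such a type is an initial
  segment of the ordinals, and every notion below depends only on the ordinals up to the one at
  hand, so its meaning does not depend on \<open>'o\<close>.  A theorem that leaves \<open>'o\<close> arbitrary therefore
  speaks about all ordinals.
\<close>

definition limit_ordinal :: "'o::{wellorder, order_bot} \<Rightarrow> bool"
  where "limit_ordinal \<alpha> \<longleftrightarrow> \<alpha> \<noteq> bot \<and> (\<forall>\<beta><\<alpha>. \<exists>\<gamma>. \<beta> < \<gamma> \<and> \<gamma> < \<alpha>)"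


section \<open>Noetherian dimension\<close>

text \<open>
  \<open>has_ndim R M \<alpha>\<close> is \<open>n-dim M = \<alpha>\<close>.  The factor \<open>M\<^sub>i\<^sub>+\<^sub>1/M\<^sub>i\<close> has elements of type \<open>'m set\<close>, and
  a recursive HOL function cannot be called at a different type.  So the recursion is
  applied to an isomorphic copy of that factor with elements of type \<open>'m\<close>, which always exists
  (take a transversal of the cosets).
\<close>

context
  notes conj_cong [fundef_cong]
begin

function has_ndim ::
    "('r, 'x) ring_scheme \<Rightarrow> ('r, 'm) module \<Rightarrow> 'o::{wellorder, order_bot} \<Rightarrow> bool"
  where "has_ndim R M \<alpha> \<longleftrightarrow>
    (if \<alpha> = bot then carrier M = {\<zero>\<^bsub>M\<^esub>}
     else \<not> (\<exists>\<beta>. \<beta> < \<alpha> \<and> has_ndim R M \<beta>) \<and>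
       (\<forall>C :: nat \<Rightarrow> 'm set.
         (\<forall>i. submodule (C i) R M) \<and> (\<forall>i. C i \<subseteq> C (Suc i)) \<longrightarrow>
         (\<exists>k. \<forall>i\<ge>k. \<exists>\<beta>. \<beta> < \<alpha> \<and>
           (\<exists>Q :: ('r, 'm) module. right_module R Q \<and>
             rmod_isomorphic R (factor_module (submod M (C (Suc i))) (C i)) Q \<and>
             has_ndim R Q \<beta>))))"
  by pat_completeness auto
termination
  by (relation "inv_image {(\<beta>, \<alpha>). \<beta> < \<alpha>} (\<lambda>(R, M, \<alpha>). \<alpha>)") (auto intro: wf)

end

declare has_ndim.simps [simp del]

lemma has_ndim_unique:
  fixes \<alpha> \<beta> :: "'o::{wellorder, order_bot}"
  assumes "has_ndim R M \<alpha>" and "has_ndim R M \<beta>"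
  shows "\<alpha> = \<beta>"
proof -
  have False if "\<gamma> < \<delta>" "has_ndim R M \<gamma>" "has_ndim R M \<delta>" for \<gamma> \<delta> :: 'o
    using that by (subst (asm) (2) has_ndim.simps) (auto split: if_splits)
  with assms show ?thesis by (metis neqE)
qed

text \<open>\<open>ndim R M\<close> is meaningful only if \<open>has_ndim R M \<alpha>\<close> for some \<open>\<alpha>\<close>; the predicates
  \<open>ndim_le\<close> and \<open>ndim_less\<close> include this existence.\<close>

definition ndim ::
    "('r, 'x) ring_scheme \<Rightarrow> ('r, 'm) module \<Rightarrow> 'o::{wellorder, order_bot}"
  where "ndim R M = (THE \<alpha>. has_ndim R M \<alpha>)"

lemma ndim_eq: "has_ndim R M \<alpha> \<Longrightarrow> ndim R M = \<alpha>"
  unfolding ndim_def by (blast intro: the_equality has_ndim_unique)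

definition ndim_le ::
    "('r, 'x) ring_scheme \<Rightarrow> ('r, 'm) module \<Rightarrow> 'o::{wellorder, order_bot} \<Rightarrow> bool"
  where "ndim_le R M \<alpha> \<longleftrightarrow> (\<exists>\<beta>\<le>\<alpha>. has_ndim R M \<beta>)"

definition ndim_less ::
    "('r, 'x) ring_scheme \<Rightarrow> ('r, 'm) module \<Rightarrow> 'o::{wellorder, order_bot} \<Rightarrow> bool"
  where "ndim_less R M \<alpha> \<longleftrightarrow> (\<exists>\<beta><\<alpha>. has_ndim R M \<beta>)"


section \<open>AB5* modules, short modules, atomic modules\<close>

definition AB5_star :: "('r, 'x) ring_scheme \<Rightarrow> ('r, 'm) module \<Rightarrow> bool"
  where "AB5_star R M \<longleftrightarrow>
    (\<forall>B \<A>. submodule B R M \<and> \<A> \<noteq> {} \<and> (\<forall>A\<in>\<A>. submodule A R M) \<and>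
        (\<forall>A\<in>\<A>. \<forall>A'\<in>\<A>. \<exists>A''\<in>\<A>. A'' \<subseteq> A \<inter> A') \<longrightarrow>
      B <+>\<^bsub>M\<^esub> (\<Inter>A\<in>\<A>. A) = (\<Inter>A\<in>\<A>. B <+>\<^bsub>M\<^esub> A))"

definition short_bound ::
    "('r, 'x) ring_scheme \<Rightarrow> ('r, 'm) module \<Rightarrow> 'o::{wellorder, order_bot} \<Rightarrow> bool"
  where "short_bound R M \<alpha> \<longleftrightarrow>
    (\<forall>N. submodule N R M \<longrightarrow> ndim_le R (submod M N) \<alpha> \<or> ndim_le R (factor_module M N) \<alpha>)"

definition short_module ::
    "('r, 'x) ring_scheme \<Rightarrow> ('r, 'm) module \<Rightarrow> 'o::{wellorder, order_bot} \<Rightarrow> bool"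
  where "short_module R M \<alpha> \<longleftrightarrow> short_bound R M \<alpha> \<and> (\<forall>\<beta><\<alpha>. \<not> short_bound R M \<beta>)"

definition short_class ::
    "('r, 'x) ring_scheme \<Rightarrow> 'o::{wellorder, order_bot} \<Rightarrow> ('r, 'm) module set"
  where "short_class R \<alpha> = {M. right_module R M \<and> short_module R M \<alpha> \<and> has_ndim R M \<alpha>}"

definition atomic_module ::
    "('r, 'x) ring_scheme \<Rightarrow> ('r, 'm) module \<Rightarrow> 'o::{wellorder, order_bot} \<Rightarrow> bool"
  where "atomic_module R A \<alpha> \<longleftrightarrow>
    carrier A \<noteq> {\<zero>\<^bsub>A\<^esub>} \<and> has_ndim R A \<alpha> \<and>
    (\<forall>N. submodule N R A \<and> N \<noteq> carrier A \<longrightarrow> ndim_less R (submod A N) \<alpha>)"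

end

theory Submission
  imports Defs "HOL-Library.Nat_Bijection"
begin

text \<open>
  A module has Noetherian dimension at most \<open>\<alpha>\<close> if and only if its lattice of submodules has, and
  factor modules are intervals of that lattice; so the argument takes place in the submodule lattice
  of \<open>M\<close> (\<open>dev_le\<close>, \<open>has_ndim_iff_dev_le\<close>).

  Write \<open>\<A>\<close> for the union of the classes \<open>short_class R \<gamma>\<close>, and let \<open>n-dim M = \<alpha>\<close>.
  If \<open>\<alpha>\<close> is a limit, then \<open>M\<close> is in \<open>\<A>\<close>, because a module that is
  \<open>\<delta>\<close>-short has dimension at most \<open>\<delta> + 1\<close> (\<open>short_bound_imp_dev_le\<close>).  If \<open>M = 0\<close>, both sides
  hold.  The case that matters is \<open>\<alpha> = \<beta> + 1\<close>, where \<open>M\<close> belongs to \<open>\<A>\<close> exactly if some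
  submodule \<open>N\<close> satisfies \<open>n-dim N = n-dim (M/N) = \<alpha>\<close>.

  Given such an \<open>N\<close>, suppose that an atomic \<open>A\<close> had \<open>n-dim (M/A) < n-dim A\<close>; then
  \<open>n-dim (M/A) \<le> \<beta>\<close>.  If \<open>A \<subseteq> N\<close>, then \<open>M/N\<close> is an image of \<open>M/A\<close> and too small.  Otherwise
  \<open>N \<inter> A\<close> is proper in \<open>A\<close>, so its dimension is at most \<open>\<beta>\<close>, and \<open>N\<close> is too small, being
  composed of \<open>N \<inter> A\<close> and a submodule of \<open>M/A\<close> (\<open>dev_le_submod_factor\<close>).

  Conversely, suppose that there is no such \<open>N\<close>, and choose \<open>A\<close> minimal with
  \<open>n-dim (M/A) \<le> \<beta>\<close>.  Then \<open>n-dim A = \<alpha>\<close>, and a proper submodule \<open>N\<close> of \<open>A\<close> has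
  \<open>n-dim (M/N) = \<alpha>\<close> by minimality, hence \<open>n-dim N \<le> \<beta>\<close>.  So \<open>A\<close> is atomic and
  \<open>n-dim A > n-dim (M/A)\<close>.  Zorn's lemma provides \<open>A\<close> as soon as \<open>n-dim (M/A) \<le> \<beta>\<close> is inherited
  by intersections of chains; this is where AB5* enters (\<open>AB5_star_dev_le_Inter\<close>).
\<close>

section \<open>The Noetherian dimension of an ordered set\<close>

text \<open>
  This reads \<open>n-dim P \<le> \<alpha>\<close>.  The case \<open>\<alpha> = bot\<close> asks for an antichain rather than for a
  one-element set; for the intervals of a submodule lattice the two agree, and with antichains
  the bound passes along every strictly monotone map, injective or not.
\<close>

context
  notes conj_cong [fundef_cong]
begin

function dev_le :: "'a::order set \<Rightarrow> 'o::{wellorder, order_bot} \<Rightarrow> bool"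
  where "dev_le P \<alpha> \<longleftrightarrow>
    (if \<alpha> = bot then \<forall>x\<in>P. \<forall>y\<in>P. \<not> x < y
     else \<forall>C :: nat \<Rightarrow> 'a. (\<forall>i. C i \<in> P) \<and> (\<forall>i. C i \<le> C (Suc i)) \<longrightarrow>
       (\<exists>k. \<forall>i\<ge>k. \<exists>\<beta>. \<beta> < \<alpha> \<and> dev_le {x \<in> P. C i \<le> x \<and> x \<le> C (Suc i)} \<beta>))"
  by pat_completeness auto
termination
  by (relation "inv_image {(\<beta>, \<alpha>). \<beta> < \<alpha>} (\<lambda>(P, \<alpha>). \<alpha>)") (auto intro: wf)

end

declare dev_le.simps [simp del]

lemma dev_le_bot: "dev_le P (bot::'o::{wellorder, order_bot}) \<longleftrightarrow> (\<forall>x\<in>P. \<forall>y\<in>P. \<not> x < y)"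
  by (subst dev_le.simps) simp

lemma dev_le_nonbot:
  fixes P :: "'a::order set" and \<alpha> :: "'o::{wellorder, order_bot}"
  assumes "\<alpha> \<noteq> bot"
  shows "dev_le P \<alpha> \<longleftrightarrow>
    (\<forall>C. (\<forall>i. C i \<in> P) \<and> (\<forall>i. C i \<le> C (Suc i)) \<longrightarrow>
       (\<exists>k. \<forall>i\<ge>k. \<exists>\<beta><\<alpha>. dev_le {x \<in> P. C i \<le> x \<and> x \<le> C (Suc i)} \<beta>))"
  using assms by (subst dev_le.simps) simp

lemma dev_le_mono:
  fixes \<alpha> \<beta> :: "'o::{wellorder, order_bot}"
  assumes "dev_le P \<beta>" and "\<beta> \<le> \<alpha>"
  shows "dev_le P \<alpha>"
proof (cases "\<alpha> = \<beta>")
  case False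
  then have lt: "\<beta> < \<alpha>" using assms(2) by simp
  then have nb: "\<alpha> \<noteq> bot" by auto
  show ?thesis
  proof (cases "\<beta> = bot")
    case True
    then have "dev_le {x \<in> P. C i \<le> x \<and> x \<le> C (Suc i)} \<beta>" for C :: "nat \<Rightarrow> 'a" and i
      using assms(1) by (auto simp: dev_le_bot)
    then show ?thesis unfolding dev_le_nonbot[OF nb] using lt by blast
  next
    case False
    then show ?thesis
      using assms(1) lt unfolding dev_le_nonbot[OF nb] dev_le_nonbot[OF False]
      by (meson order.strict_trans)
  qed
qed (use assms in simp)

text \<open>
  A chain in \<open>P\<close> is sent to chains in \<open>Q\<close> and \<open>Q'\<close>, and each of its steps embeds in the same way
  into the product of the two image steps; so the dimension of \<open>P\<close> is at most that of the product.
  Applied to \<open>K \<mapsto> (K \<inter> A, K + A)\<close> this yields \<open>n-dim M \<le> max (n-dim A) (n-dim (M/A))\<close>.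
\<close>

lemma dev_le_pair:
  fixes P :: "'a::order set" and Q :: "'b::order set" and Q' :: "'c::order set"
    and \<alpha> :: "'o::{wellorder, order_bot}"
  assumes "f ` P \<subseteq> Q" and "g ` P \<subseteq> Q'"
    and "\<And>x y. \<lbrakk>x \<in> P; y \<in> P; x < y\<rbrakk> \<Longrightarrow> f x \<le> f y \<and> g x \<le> g y \<and> (f x < f y \<or> g x < g y)"
    and "dev_le Q \<alpha>" and "dev_le Q' \<alpha>"
  shows "dev_le P \<alpha>"
  using assms
proof (induction \<alpha> arbitrary: P Q Q' rule: less_induct)
  case (less \<alpha>)
  note fP = less.prems(1) and gP = less.prems(2) and str = less.prems(3)
  have mono: "f x \<le> f y" "g x \<le> g y" if "x \<in> P" "y \<in> P" "x \<le> y" for x y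
    using str[OF that(1,2)] that(3) by (cases "x = y"; auto)+
  show ?case
  proof (cases "\<alpha> = bot")
    case True
    have "\<not> x < y" if xy: "x \<in> P" "y \<in> P" for x y
    proof
      assume "x < y"
      then have "f x < f y \<or> g x < g y" using str xy by blast
      moreover have "\<not> f x < f y" "\<not> g x < g y"
        using less.prems(4,5) xy fP gP unfolding True dev_le_bot by blast+
      ultimately show False by simp
    qed
    then show ?thesis unfolding True dev_le_bot by blast
  next
    case False
    show ?thesis unfolding dev_le_nonbot[OF False]
    proof (intro allI impI)
      fix C :: "nat \<Rightarrow> 'a"
      assume "(\<forall>i. C i \<in> P) \<and> (\<forall>i. C i \<le> C (Suc i))"
      then have CP: "C i \<in> P" and Cle: "C i \<le> C (Suc i)" for i by auto
      have "(\<forall>i. f (C i) \<in> Q) \<and> (\<forall>i. f (C i) \<le> f (C (Suc i)))"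
        using CP Cle fP mono by blast
      then obtain k where k: "\<forall>i\<ge>k. \<exists>\<beta><\<alpha>.
          dev_le {x \<in> Q. f (C i) \<le> x \<and> x \<le> f (C (Suc i))} \<beta>"
        using less.prems(4)[unfolded dev_le_nonbot[OF False], rule_format, of "\<lambda>i. f (C i)"]
        by blast
      have "(\<forall>i. g (C i) \<in> Q') \<and> (\<forall>i. g (C i) \<le> g (C (Suc i)))"
        using CP Cle gP mono by blast
      then obtain l where l: "\<forall>i\<ge>l. \<exists>\<beta><\<alpha>.
          dev_le {x \<in> Q'. g (C i) \<le> x \<and> x \<le> g (C (Suc i))} \<beta>"
        using less.prems(5)[unfolded dev_le_nonbot[OF False], rule_format, of "\<lambda>i. g (C i)"]
        by blast
      show "\<exists>k. \<forall>i\<ge>k. \<exists>\<beta><\<alpha>. dev_le {x \<in> P. C i \<le> x \<and> x \<le> C (Suc i)} \<beta>"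
      proof (rule exI[of _ "max k l"], intro allI impI)
        fix i assume i: "max k l \<le> i"
        obtain \<beta> where \<beta>: "\<beta> < \<alpha>" "dev_le {x \<in> Q. f (C i) \<le> x \<and> x \<le> f (C (Suc i))} \<beta>"
          using k i by auto
        obtain \<gamma> where \<gamma>: "\<gamma> < \<alpha>" "dev_le {x \<in> Q'. g (C i) \<le> x \<and> x \<le> g (C (Suc i))} \<gamma>"
          using l i by auto
        have "dev_le {x \<in> P. C i \<le> x \<and> x \<le> C (Suc i)} (max \<beta> \<gamma>)"
        proof (rule less.IH)
          show "max \<beta> \<gamma> < \<alpha>" using \<beta> \<gamma> by simp
          show "f ` {x \<in> P. C i \<le> x \<and> x \<le> C (Suc i)}
              \<subseteq> {x \<in> Q. f (C i) \<le> x \<and> x \<le> f (C (Suc i))}"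
            using fP mono CP by auto
          show "g ` {x \<in> P. C i \<le> x \<and> x \<le> C (Suc i)}
              \<subseteq> {x \<in> Q'. g (C i) \<le> x \<and> x \<le> g (C (Suc i))}"
            using gP mono CP by auto
          show "dev_le {x \<in> Q. f (C i) \<le> x \<and> x \<le> f (C (Suc i))} (max \<beta> \<gamma>)"
            using \<beta>(2) by (rule dev_le_mono) simp
          show "dev_le {x \<in> Q'. g (C i) \<le> x \<and> x \<le> g (C (Suc i))} (max \<beta> \<gamma>)"
            using \<gamma>(2) by (rule dev_le_mono) simp
        qed (use str in blast)
        then show "\<exists>\<beta><\<alpha>. dev_le {x \<in> P. C i \<le> x \<and> x \<le> C (Suc i)} \<beta>"
          using \<beta> \<gamma> by (metis max_less_iff_conj)
      qed
    qed
  qed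
qed

lemma dev_le_strict_mono:
  fixes P :: "'a::order set" and Q :: "'b::order set"
  assumes "f ` P \<subseteq> Q" and "\<And>x y. \<lbrakk>x \<in> P; y \<in> P; x < y\<rbrakk> \<Longrightarrow> f x < f y" and "dev_le Q \<alpha>"
  shows "dev_le P \<alpha>"
  by (rule dev_le_pair[where f = f and g = f, OF assms(1) assms(1) _ assms(3) assms(3)])
    (use assms(2) in force)

lemma dev_le_subset: "\<lbrakk>dev_le Q \<alpha>; P \<subseteq> Q\<rbrakk> \<Longrightarrow> dev_le P \<alpha>"
  by (rule dev_le_strict_mono[where f = "\<lambda>x. x"]) auto

text \<open>
  Split \<open>\<nat>\<close> into infinitely many infinite blocks.  The unions of the first \<open>i\<close> blocks form a chain
  each of whose steps again contains a copy of the power set of \<open>\<nat>\<close>, so no dimension can be the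
  least one.
\<close>

lemma not_dev_le_Pow_nat: "\<not> dev_le (UNIV :: nat set set) (\<alpha> :: 'o::{wellorder, order_bot})"
proof (induction \<alpha> rule: less_induct)
  case (less \<alpha>)
  show ?case
  proof (cases "\<alpha> = bot")
    case True
    have "({} :: nat set) < UNIV" by auto
    then show ?thesis unfolding True dev_le_bot by blast
  next
    case False
    define C :: "nat \<Rightarrow> nat set" where "C i = {n. fst (prod_decode n :: nat \<times> nat) < i}" for i
    have "C i \<le> C (Suc i)" for i by (auto simp: C_def)
    moreover have "\<not> dev_le {x \<in> UNIV. C i \<le> x \<and> x \<le> C (Suc i)} \<beta>" if "\<beta> < \<alpha>" for i \<beta>
    proof
      define \<phi> where "\<phi> S = C i \<union> (\<lambda>j. prod_encode (i, j)) ` S" for S :: "nat set"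
      have mem: "prod_encode (i, j) \<in> \<phi> S \<longleftrightarrow> j \<in> S" for j S
        by (auto simp: \<phi>_def C_def)
      assume "dev_le {x \<in> UNIV. C i \<le> x \<and> x \<le> C (Suc i)} \<beta>"
      then have "dev_le (UNIV :: nat set set) \<beta>"
      proof (rule dev_le_strict_mono[rotated 2])
        show "range \<phi> \<subseteq> {x \<in> UNIV. C i \<le> x \<and> x \<le> C (Suc i)}"
          by (auto simp: \<phi>_def C_def)
        show "\<phi> S < \<phi> T" if "S < T" for S T
        proof -
          have "\<phi> S \<subseteq> \<phi> T" using that by (auto simp: \<phi>_def)
          moreover have "\<phi> S \<noteq> \<phi> T" using that mem by blast
          ultimately show ?thesis by blast
        qed
      qed
      then show False using less that by blast
    qed
    ultimately show ?thesis unfolding dev_le_nonbot[OF False] by blast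
  qed
qed


section \<open>Submodules, factor modules and their dimension\<close>

definition submods :: "('r, 'x) ring_scheme \<Rightarrow> ('r, 'm, 'y) module_scheme \<Rightarrow> 'm set set"
  where "submods R M = {K. submodule K R M}"

context right_module
begin

lemma smult_zero_left:
  assumes "x \<in> carrier M"
  shows "\<zero>\<^bsub>R\<^esub> \<odot>\<^bsub>M\<^esub> x = \<zero>\<^bsub>M\<^esub>"
proof -
  have "\<zero>\<^bsub>R\<^esub> \<odot>\<^bsub>M\<^esub> x \<oplus>\<^bsub>M\<^esub> \<zero>\<^bsub>R\<^esub> \<odot>\<^bsub>M\<^esub> x = \<zero>\<^bsub>R\<^esub> \<odot>\<^bsub>M\<^esub> x \<oplus>\<^bsub>M\<^esub> \<zero>\<^bsub>M\<^esub>"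
    using smult_l_distr[of "\<zero>\<^bsub>R\<^esub>" "\<zero>\<^bsub>R\<^esub>" x] assms by simp
  then show ?thesis using assms by simp
qed

lemma smult_minus_one:
  assumes "x \<in> carrier M"
  shows "(\<ominus>\<^bsub>R\<^esub> \<one>\<^bsub>R\<^esub>) \<odot>\<^bsub>M\<^esub> x = \<ominus>\<^bsub>M\<^esub> x"
proof -
  have "(\<ominus>\<^bsub>R\<^esub> \<one>\<^bsub>R\<^esub>) \<odot>\<^bsub>M\<^esub> x \<oplus>\<^bsub>M\<^esub> x = \<zero>\<^bsub>M\<^esub>"
    using smult_l_distr[of "\<ominus>\<^bsub>R\<^esub> \<one>\<^bsub>R\<^esub>" "\<one>\<^bsub>R\<^esub>" x] assms
    by (simp add: smult_zero_left R.l_neg)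
  then show ?thesis using assms by (simp add: M.minus_equality)
qed

text \<open>Negatives can be left out of the closure conditions: they come from the scalar \<open>-1\<close>.\<close>

lemma submods_iff:
  "K \<in> submods R M \<longleftrightarrow> K \<subseteq> carrier M \<and> \<zero>\<^bsub>M\<^esub> \<in> K \<and>
     (\<forall>x\<in>K. \<forall>y\<in>K. x \<oplus>\<^bsub>M\<^esub> y \<in> K) \<and> (\<forall>r\<in>carrier R. \<forall>x\<in>K. r \<odot>\<^bsub>M\<^esub> x \<in> K)"
proof
  assume "K \<in> submods R M"
  then interpret submodule K R M by (simp add: submods_def)
  show "K \<subseteq> carrier M \<and> \<zero>\<^bsub>M\<^esub> \<in> K \<and>
     (\<forall>x\<in>K. \<forall>y\<in>K. x \<oplus>\<^bsub>M\<^esub> y \<in> K) \<and> (\<forall>r\<in>carrier R. \<forall>x\<in>K. r \<odot>\<^bsub>M\<^esub> x \<in> K)"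
    using subset m_closed one_closed smult_closed by auto
next
  assume K: "K \<subseteq> carrier M \<and> \<zero>\<^bsub>M\<^esub> \<in> K \<and>
     (\<forall>x\<in>K. \<forall>y\<in>K. x \<oplus>\<^bsub>M\<^esub> y \<in> K) \<and> (\<forall>r\<in>carrier R. \<forall>x\<in>K. r \<odot>\<^bsub>M\<^esub> x \<in> K)"
  then have "\<ominus>\<^bsub>M\<^esub> x \<in> K" if "x \<in> K" for x
    using that smult_minus_one by (metis R.add.inv_closed R.one_closed subsetD)
  then have "subgroup K (add_monoid M)"
    using K by (intro M.add.subgroupI) auto
  then show "K \<in> submods R M"
    using K by (auto simp: submods_def submodule_def submodule_axioms_def)
qed

lemma submods_subset: "K \<in> submods R M \<Longrightarrow> K \<subseteq> carrier M"
  and submods_zero: "K \<in> submods R M \<Longrightarrow> \<zero>\<^bsub>M\<^esub> \<in> K"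
  and submods_add: "\<lbrakk>K \<in> submods R M; x \<in> K; y \<in> K\<rbrakk> \<Longrightarrow> x \<oplus>\<^bsub>M\<^esub> y \<in> K"
  and submods_smult: "\<lbrakk>K \<in> submods R M; r \<in> carrier R; x \<in> K\<rbrakk> \<Longrightarrow> r \<odot>\<^bsub>M\<^esub> x \<in> K"
  by (auto simp: submods_iff)

lemma submods_minus: "\<lbrakk>K \<in> submods R M; x \<in> K\<rbrakk> \<Longrightarrow> \<ominus>\<^bsub>M\<^esub> x \<in> K"
  by (metis R.add.inv_closed R.one_closed smult_minus_one submods_smult submods_subset subsetD)

lemma submods_diff:
  assumes "K \<in> submods R M" and "x \<oplus>\<^bsub>M\<^esub> y \<in> K" and "x \<in> K" and "y \<in> carrier M"
  shows "y \<in> K"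
proof -
  have "\<ominus>\<^bsub>M\<^esub> x \<oplus>\<^bsub>M\<^esub> (x \<oplus>\<^bsub>M\<^esub> y) = y"
    using assms submods_subset by (intro M.r_neg1) auto
  then show ?thesis using assms by (metis submods_add submods_minus)
qed

lemma carrier_submods: "carrier M \<in> submods R M"
  by (auto simp: submods_iff)

lemma zero_submods: "{\<zero>\<^bsub>M\<^esub>} \<in> submods R M"
proof -
  have "r \<odot>\<^bsub>M\<^esub> \<zero>\<^bsub>M\<^esub> = \<zero>\<^bsub>M\<^esub>" if "r \<in> carrier R" for r
  proof -
    have "r \<odot>\<^bsub>M\<^esub> \<zero>\<^bsub>M\<^esub> \<oplus>\<^bsub>M\<^esub> r \<odot>\<^bsub>M\<^esub> \<zero>\<^bsub>M\<^esub> = r \<odot>\<^bsub>M\<^esub> \<zero>\<^bsub>M\<^esub> \<oplus>\<^bsub>M\<^esub> \<zero>\<^bsub>M\<^esub>"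
      using smult_r_distr[of r "\<zero>\<^bsub>M\<^esub>" "\<zero>\<^bsub>M\<^esub>"] that by simp
    then show ?thesis using that by simp
  qed
  then show ?thesis by (auto simp: submods_iff)
qed

lemma Int_submods: "\<lbrakk>K \<in> submods R M; L \<in> submods R M\<rbrakk> \<Longrightarrow> K \<inter> L \<in> submods R M"
  by (auto simp: submods_iff)

lemma Inter_submods: "\<lbrakk>\<A> \<noteq> {}; \<A> \<subseteq> submods R M\<rbrakk> \<Longrightarrow> \<Inter>\<A> \<in> submods R M"
  by (fastforce simp: submods_iff subset_iff)

lemma mem_set_add: "x \<in> K <+>\<^bsub>M\<^esub> L \<longleftrightarrow> (\<exists>k\<in>K. \<exists>l\<in>L. x = k \<oplus>\<^bsub>M\<^esub> l)"
  by (auto simp: set_add_def')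

lemma set_add_submods:
  assumes "K \<in> submods R M" and "L \<in> submods R M"
  shows "K <+>\<^bsub>M\<^esub> L \<in> submods R M"
proof -
  note K = assms(1)[unfolded submods_iff] and L = assms(2)[unfolded submods_iff]
  have c: "x \<in> carrier M" if "x \<in> K \<or> x \<in> L" for x using that K L by auto
  have "\<zero>\<^bsub>M\<^esub> \<in> K <+>\<^bsub>M\<^esub> L" unfolding mem_set_add using K L by (metis M.r_zero M.zero_closed)
  moreover have "(k \<oplus>\<^bsub>M\<^esub> l) \<oplus>\<^bsub>M\<^esub> (k' \<oplus>\<^bsub>M\<^esub> l') \<in> K <+>\<^bsub>M\<^esub> L"
    if "k \<in> K" "k' \<in> K" "l \<in> L" "l' \<in> L" for k k' l l'
  proof -
    have "(k \<oplus>\<^bsub>M\<^esub> l) \<oplus>\<^bsub>M\<^esub> (k' \<oplus>\<^bsub>M\<^esub> l') = (k \<oplus>\<^bsub>M\<^esub> k') \<oplus>\<^bsub>M\<^esub> (l \<oplus>\<^bsub>M\<^esub> l')"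
      using that c by (simp add: M.a_ac)
    then show ?thesis unfolding mem_set_add using that K L by blast
  qed
  moreover have "r \<odot>\<^bsub>M\<^esub> (k \<oplus>\<^bsub>M\<^esub> l) \<in> K <+>\<^bsub>M\<^esub> L"
    if "k \<in> K" "l \<in> L" "r \<in> carrier R" for k l r
    unfolding mem_set_add using that K L c smult_r_distr[of r k l] by blast
  moreover have "K <+>\<^bsub>M\<^esub> L \<subseteq> carrier M"
    by (auto simp: mem_set_add c)
  ultimately show ?thesis unfolding submods_iff by (auto simp: mem_set_add)
qed

lemma set_add_upper:
  assumes "K \<in> submods R M" and "L \<in> submods R M"
  shows "K \<subseteq> K <+>\<^bsub>M\<^esub> L" and "L \<subseteq> K <+>\<^bsub>M\<^esub> L"
proof -
  note K = assms(1)[unfolded submods_iff] and L = assms(2)[unfolded submods_iff]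
  show "K \<subseteq> K <+>\<^bsub>M\<^esub> L"
    unfolding subset_iff mem_set_add using K L by (metis M.r_zero subsetD)
  show "L \<subseteq> K <+>\<^bsub>M\<^esub> L"
    unfolding subset_iff mem_set_add using K L by (metis M.l_zero subsetD)
qed

lemma set_add_mono: "K \<subseteq> L \<Longrightarrow> K <+>\<^bsub>M\<^esub> A \<subseteq> L <+>\<^bsub>M\<^esub> A"
  unfolding subset_iff mem_set_add by blast

text \<open>The modular law, in the form in which a pair \<open>K < L\<close> cannot collapse both in \<open>A\<close> and modulo \<open>A\<close>.\<close>

lemma modular_collapse:
  assumes "K \<in> submods R M" and "L \<in> submods R M" and "A \<in> submods R M"
    and "K \<subseteq> L" and "L \<inter> A \<subseteq> K" and "L <+>\<^bsub>M\<^esub> A \<subseteq> K <+>\<^bsub>M\<^esub> A"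
  shows "L = K"
proof
  show "L \<subseteq> K"
  proof
    fix x assume x: "x \<in> L"
    then have "x \<in> K <+>\<^bsub>M\<^esub> A" using set_add_upper[OF assms(2,3)] assms(6) by blast
    then obtain k a where ka: "k \<in> K" "a \<in> A" "x = k \<oplus>\<^bsub>M\<^esub> a" unfolding mem_set_add by blast
    then have "a \<in> L"
      using x assms submods_diff[OF assms(2)] submods_subset by blast
    then show "x \<in> K" using ka assms submods_add by blast
  qed
qed (use assms in simp)

lemma right_module_submod:
  assumes "N \<in> submods R M"
  shows "right_module R (M\<lparr>carrier := N\<rparr>)"
proof -
  note N = assms[unfolded submods_iff]
  have c: "x \<in> carrier M" if "x \<in> N" for x using that N by auto
  have "abelian_group (M\<lparr>carrier := N\<rparr>)"
  proof (rule abelian_groupI)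
    fix x assume x: "x \<in> carrier (M\<lparr>carrier := N\<rparr>)"
    then have "\<ominus>\<^bsub>M\<^esub> x \<in> N" "\<ominus>\<^bsub>M\<^esub> x \<oplus>\<^bsub>M\<^esub> x = \<zero>\<^bsub>M\<^esub>"
      using submods_minus[OF assms] c M.l_neg by auto
    then show "\<exists>y\<in>carrier (M\<lparr>carrier := N\<rparr>).
        y \<oplus>\<^bsub>M\<lparr>carrier := N\<rparr>\<^esub> x = \<zero>\<^bsub>M\<lparr>carrier := N\<rparr>\<^esub>" by auto
  qed (use N c in \<open>auto simp: M.a_ac\<close>)
  then show ?thesis
    using N c by (auto simp: right_module_def right_module_axioms_def R.ring_axioms
        smult_l_distr smult_r_distr smult_assoc)
qed

lemma submods_submod:
  assumes "N \<in> submods R M"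
  shows "submods R (M\<lparr>carrier := N\<rparr>) = {K \<in> submods R M. K \<subseteq> N}"
proof -
  interpret N: right_module R "M\<lparr>carrier := N\<rparr>" by (rule right_module_submod[OF assms])
  show ?thesis using submods_subset[OF assms] by (auto simp: N.submods_iff submods_iff subset_iff)
qed

end

text \<open>
  \<open>Q\<close> is deliberately not assumed to be a module: the axioms are inherited from \<open>M\<close> along \<open>h\<close>,
  which is how factor modules and their isomorphic copies are recognised as modules.
\<close>

definition linear_onto ::
    "('r, 'x) ring_scheme \<Rightarrow> ('r, 'm, 'y) module_scheme \<Rightarrow> ('r, 'q, 'z) module_scheme \<Rightarrow>
      ('m \<Rightarrow> 'q) \<Rightarrow> bool"
  where "linear_onto R M Q h \<longleftrightarrow> h ` carrier M = carrier Q \<and> h \<zero>\<^bsub>M\<^esub> = \<zero>\<^bsub>Q\<^esub> \<and>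
    (\<forall>x\<in>carrier M. \<forall>y\<in>carrier M. h (x \<oplus>\<^bsub>M\<^esub> y) = h x \<oplus>\<^bsub>Q\<^esub> h y) \<and>
    (\<forall>r\<in>carrier R. \<forall>x\<in>carrier M. h (r \<odot>\<^bsub>M\<^esub> x) = r \<odot>\<^bsub>Q\<^esub> h x)"

lemma right_module_linear_onto:
  assumes "right_module R M" and "linear_onto R M Q h"
  shows "right_module R Q"
proof -
  interpret right_module R M by fact
  note [simp] = assms(2)[unfolded linear_onto_def, THEN conjunct1, symmetric]
  have zero: "\<zero>\<^bsub>Q\<^esub> = h \<zero>\<^bsub>M\<^esub>" using assms(2) by (simp add: linear_onto_def)
  have add: "h x \<oplus>\<^bsub>Q\<^esub> h y = h (x \<oplus>\<^bsub>M\<^esub> y)" if "x \<in> carrier M" "y \<in> carrier M" for x y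
    using that assms(2) by (simp add: linear_onto_def)
  have smult: "r \<odot>\<^bsub>Q\<^esub> h x = h (r \<odot>\<^bsub>M\<^esub> x)" if "r \<in> carrier R" "x \<in> carrier M" for r x
    using that assms(2) by (simp add: linear_onto_def)
  have "abelian_group Q"
  proof (rule abelian_groupI)
    fix q assume "q \<in> carrier Q"
    then obtain x where x: "x \<in> carrier M" "q = h x" by auto
    have "h (\<ominus>\<^bsub>M\<^esub> x) \<oplus>\<^bsub>Q\<^esub> q = \<zero>\<^bsub>Q\<^esub>" using x by (simp add: add zero M.l_neg)
    then show "\<exists>y\<in>carrier Q. y \<oplus>\<^bsub>Q\<^esub> q = \<zero>\<^bsub>Q\<^esub>" using x by auto
  qed (auto simp: add zero M.a_ac)
  then show ?thesis
    by (auto simp: right_module_def right_module_axioms_def R.ring_axioms add smult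
        smult_l_distr smult_r_distr smult_assoc)
qed

text \<open>
  The correspondence theorem: image and preimage are inverse to each other between the submodules
  above the kernel and those of \<open>Q\<close>.
\<close>

lemma dev_le_linear_onto:
  assumes M: "right_module R M" and h: "linear_onto R M Q h"
  shows "dev_le (submods R Q) \<alpha> \<longleftrightarrow>
    dev_le {K \<in> submods R M. {x \<in> carrier M. h x = \<zero>\<^bsub>Q\<^esub>} \<subseteq> K} \<alpha>"
proof
  interpret right_module R M by fact
  interpret Q: right_module R Q by (rule right_module_linear_onto[OF M h])
  have onto: "carrier Q = h ` carrier M" and zero: "h \<zero>\<^bsub>M\<^esub> = \<zero>\<^bsub>Q\<^esub>"
    using h by (auto simp: linear_onto_def)
  have add: "h (x \<oplus>\<^bsub>M\<^esub> y) = h x \<oplus>\<^bsub>Q\<^esub> h y" if "x \<in> carrier M" "y \<in> carrier M" for x y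
    using that h by (simp add: linear_onto_def)
  have smult: "h (r \<odot>\<^bsub>M\<^esub> x) = r \<odot>\<^bsub>Q\<^esub> h x" if "r \<in> carrier R" "x \<in> carrier M" for r x
    using that h by (simp add: linear_onto_def)
  let ?ker = "{x \<in> carrier M. h x = \<zero>\<^bsub>Q\<^esub>}"
  let ?U = "{K \<in> submods R M. ?ker \<subseteq> K}"
  let ?inv = "\<lambda>L. {x \<in> carrier M. h x \<in> L}"
  have img: "h ` K \<in> submods R Q" if K: "K \<in> submods R M" for K
  proof -
    have "h ` K \<subseteq> carrier Q" using K submods_subset onto by blast
    moreover have "\<zero>\<^bsub>Q\<^esub> \<in> h ` K" using K submods_zero zero by (metis imageI)
    moreover have "h x \<oplus>\<^bsub>Q\<^esub> h y \<in> h ` K" if "x \<in> K" "y \<in> K" for x y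
    proof -
      have "x \<in> carrier M" "y \<in> carrier M" using that submods_subset[OF K] by auto
      then have "h x \<oplus>\<^bsub>Q\<^esub> h y = h (x \<oplus>\<^bsub>M\<^esub> y)" by (simp add: add)
      then show ?thesis using submods_add[OF K that] by simp
    qed
    moreover have "r \<odot>\<^bsub>Q\<^esub> h x \<in> h ` K" if "x \<in> K" "r \<in> carrier R" for x r
    proof -
      have "r \<odot>\<^bsub>Q\<^esub> h x = h (r \<odot>\<^bsub>M\<^esub> x)" using that submods_subset[OF K] smult by auto
      then show ?thesis using submods_smult[OF K that(2,1)] by simp
    qed
    ultimately show ?thesis by (auto simp: Q.submods_iff)
  qed
  have inv: "?inv L \<in> ?U" if "L \<in> submods R Q" for L
    using that by (auto simp: Q.submods_iff submods_iff zero add smult)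
  have inv_img: "?inv (h ` K) = K" if K: "K \<in> ?U" for K
  proof
    show "?inv (h ` K) \<subseteq> K"
    proof
      fix x assume "x \<in> ?inv (h ` K)"
      then obtain k where x: "x \<in> carrier M" "k \<in> K" "h x = h k" by auto
      then have k: "k \<in> carrier M" using K submods_subset by auto
      have m: "\<ominus>\<^bsub>M\<^esub> k \<in> carrier M" using k by simp
      have "h (\<ominus>\<^bsub>M\<^esub> k \<oplus>\<^bsub>M\<^esub> x) = h (\<ominus>\<^bsub>M\<^esub> k \<oplus>\<^bsub>M\<^esub> k)"
        using m k x by (simp only: add)
      then have "\<ominus>\<^bsub>M\<^esub> k \<oplus>\<^bsub>M\<^esub> x \<in> ?ker" using m k x by (simp add: zero M.l_neg)
      then have "\<ominus>\<^bsub>M\<^esub> k \<oplus>\<^bsub>M\<^esub> x \<in> K" using K by auto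
      then show "x \<in> K" using K x m submods_minus[of K k] submods_diff[of K "\<ominus>\<^bsub>M\<^esub> k" x] by auto
    qed
  qed (use K submods_subset in auto)
  have img_inv: "h ` ?inv L = L" if "L \<in> submods R Q" for L
    using that onto by (auto simp: Q.submods_iff)
  show "dev_le ?U \<alpha>" if "dev_le (submods R Q) \<alpha>"
    using that
  proof (rule dev_le_strict_mono[rotated 2])
    show "(`) h ` ?U \<subseteq> submods R Q" using img by auto
    fix K L assume KL: "K \<in> ?U" "L \<in> ?U" "K < L"
    have "h ` K \<noteq> h ` L"
    proof
      assume "h ` K = h ` L"
      then have "?inv (h ` K) = ?inv (h ` L)" by (simp only:)
      then have "K = L" unfolding inv_img[OF KL(1)] inv_img[OF KL(2)] .
      then show False using KL(3) by simp
    qed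
    moreover have "h ` K \<subseteq> h ` L" using KL(3) by (auto simp: psubset_eq)
    ultimately show "h ` K < h ` L" by (rule psubsetI[rotated])
  qed
  show "dev_le (submods R Q) \<alpha>" if "dev_le ?U \<alpha>"
    using that
  proof (rule dev_le_strict_mono[rotated 2])
    show "?inv ` submods R Q \<subseteq> ?U" using inv by auto
    fix K L assume KL: "K \<in> submods R Q" "L \<in> submods R Q" "K < L"
    have "?inv K \<noteq> ?inv L"
    proof
      assume "?inv K = ?inv L"
      then have "h ` ?inv K = h ` ?inv L" by (simp only:)
      then have "K = L" unfolding img_inv[OF KL(1)] img_inv[OF KL(2)] .
      then show False using KL(3) by simp
    qed
    moreover have "?inv K \<subseteq> ?inv L" using KL(3) by (auto simp: psubset_eq)
    ultimately show "?inv K < ?inv L" by (rule psubsetI[rotated])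
  qed
qed

text \<open>
  All members of the union that defines the scalar action on a coset are the same coset, because
  \<open>N\<close> is closed under scalars.  Together with the other two facts this makes \<open>x \<mapsto> N + x\<close> a
  linear map with kernel \<open>N\<close>.
\<close>

lemma (in right_module)
  assumes "N \<in> submods R M"
  shows coset_eq_iff: "x \<in> carrier M \<Longrightarrow> N +>\<^bsub>M\<^esub> x = N \<longleftrightarrow> x \<in> N"
    and coset_smult: "\<lbrakk>r \<in> carrier R; x \<in> carrier M\<rbrakk> \<Longrightarrow>
      (\<Union>y\<in>N +>\<^bsub>M\<^esub> x. N +>\<^bsub>M\<^esub> (r \<odot>\<^bsub>M\<^esub> y)) = N +>\<^bsub>M\<^esub> (r \<odot>\<^bsub>M\<^esub> x)"
    and coset_add: "\<lbrakk>x \<in> carrier M; y \<in> carrier M\<rbrakk> \<Longrightarrow>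
      (N +>\<^bsub>M\<^esub> x) <+>\<^bsub>M\<^esub> (N +>\<^bsub>M\<^esub> y) = N +>\<^bsub>M\<^esub> (x \<oplus>\<^bsub>M\<^esub> y)"
proof -
  interpret N: abelian_subgroup N M
    using assms M.abelian_group_axioms
    by (auto simp: submods_def submodule_def intro: abelian_subgroupI3 additive_subgroupI)
  show "N +>\<^bsub>M\<^esub> x = N \<longleftrightarrow> x \<in> N" if "x \<in> carrier M"
    using that N.a_rcos_self N.a_rcos_const by blast
  show "(N +>\<^bsub>M\<^esub> x) <+>\<^bsub>M\<^esub> (N +>\<^bsub>M\<^esub> y) = N +>\<^bsub>M\<^esub> (x \<oplus>\<^bsub>M\<^esub> y)" if "x \<in> carrier M" "y \<in> carrier M"
    using that by (rule N.a_rcos_sum)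
  show "(\<Union>y\<in>N +>\<^bsub>M\<^esub> x. N +>\<^bsub>M\<^esub> (r \<odot>\<^bsub>M\<^esub> y)) = N +>\<^bsub>M\<^esub> (r \<odot>\<^bsub>M\<^esub> x)"
    if r: "r \<in> carrier R" and x: "x \<in> carrier M"
  proof -
    have "N +>\<^bsub>M\<^esub> (r \<odot>\<^bsub>M\<^esub> y) = N +>\<^bsub>M\<^esub> (r \<odot>\<^bsub>M\<^esub> x)" if y: "y \<in> N +>\<^bsub>M\<^esub> x" for y
    proof -
      obtain n where n: "n \<in> N" "y = n \<oplus>\<^bsub>M\<^esub> x" using y by (auto simp: a_r_coset_def')
      then have "r \<odot>\<^bsub>M\<^esub> y = r \<odot>\<^bsub>M\<^esub> n \<oplus>\<^bsub>M\<^esub> r \<odot>\<^bsub>M\<^esub> x" using r x smult_r_distr by auto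
      moreover have "r \<odot>\<^bsub>M\<^esub> n \<in> N" using r n assms submods_smult by blast
      ultimately have "r \<odot>\<^bsub>M\<^esub> y \<in> N +>\<^bsub>M\<^esub> (r \<odot>\<^bsub>M\<^esub> x)" by (auto simp: a_r_coset_def')
      then show ?thesis using r x N.a_repr_independence' by blast
    qed
    then show ?thesis using N.a_rcos_self[OF x] by blast
  qed
qed

lemma linear_onto_factor_module:
  fixes M :: "('r, 'm) module"
  assumes "right_module R M" and "N \<in> submods R M"
  shows "linear_onto R M (factor_module M N) (\<lambda>x. N +>\<^bsub>M\<^esub> x)"
proof -
  interpret right_module R M by fact
  show ?thesis
    using coset_eq_iff[OF assms(2) M.zero_closed] submods_zero[OF assms(2)]
    by (auto simp: linear_onto_def factor_module_def A_RCOSETS_def' coset_add[OF assms(2)]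
        coset_smult[OF assms(2)])
qed

lemma right_module_factor_module:
  fixes M :: "('r, 'm) module"
  assumes "right_module R M" and "N \<in> submods R M"
  shows "right_module R (factor_module M N)"
  using right_module_linear_onto[OF assms(1) linear_onto_factor_module[OF assms]] .

lemma dev_le_factor_module:
  fixes M :: "('r, 'm) module"
  assumes "right_module R M" and "N \<in> submods R M"
  shows "dev_le (submods R (factor_module M N)) \<alpha> \<longleftrightarrow> dev_le {K \<in> submods R M. N \<subseteq> K} \<alpha>"
proof -
  interpret right_module R M by fact
  have "{x \<in> carrier M. N +>\<^bsub>M\<^esub> x = \<zero>\<^bsub>factor_module M N\<^esub>} = N"
    using coset_eq_iff[OF assms(2)] submods_subset[OF assms(2)] by (auto simp: factor_module_def)
  then show ?thesis
    using dev_le_linear_onto[OF assms(1) linear_onto_factor_module[OF assms]] by simp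
qed

lemma dev_le_rmod_isomorphic:
  assumes "right_module R M" and "right_module R Q" and "rmod_isomorphic R M Q"
  shows "dev_le (submods R M) \<alpha> \<longleftrightarrow> dev_le (submods R Q) \<alpha>"
proof -
  interpret M: right_module R M by fact
  interpret Q: right_module R Q by fact
  obtain h where bij: "bij_betw h (carrier M) (carrier Q)"
    and add: "\<And>x y. \<lbrakk>x \<in> carrier M; y \<in> carrier M\<rbrakk> \<Longrightarrow> h (x \<oplus>\<^bsub>M\<^esub> y) = h x \<oplus>\<^bsub>Q\<^esub> h y"
    and smult: "\<And>r x. \<lbrakk>r \<in> carrier R; x \<in> carrier M\<rbrakk> \<Longrightarrow> h (r \<odot>\<^bsub>M\<^esub> x) = r \<odot>\<^bsub>Q\<^esub> h x"
    using assms(3) unfolding rmod_isomorphic_def by blast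
  have onto: "h ` carrier M = carrier Q" using bij by (simp add: bij_betw_def)
  then have h0: "h \<zero>\<^bsub>M\<^esub> \<in> carrier Q" by blast
  have "\<zero>\<^bsub>R\<^esub> \<odot>\<^bsub>M\<^esub> \<zero>\<^bsub>M\<^esub> = \<zero>\<^bsub>M\<^esub>" by (simp add: M.smult_zero_left)
  then have zero: "h \<zero>\<^bsub>M\<^esub> = \<zero>\<^bsub>Q\<^esub>"
    using smult[of "\<zero>\<^bsub>R\<^esub>" "\<zero>\<^bsub>M\<^esub>"] Q.smult_zero_left[OF h0] by simp
  have "linear_onto R M Q h" using onto zero add smult by (simp add: linear_onto_def)
  then have "dev_le (submods R Q) \<alpha> \<longleftrightarrow>
      dev_le {K \<in> submods R M. {x \<in> carrier M. h x = \<zero>\<^bsub>Q\<^esub>} \<subseteq> K} \<alpha>"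
    by (rule dev_le_linear_onto[OF assms(1)])
  also have "{x \<in> carrier M. h x = \<zero>\<^bsub>Q\<^esub>} = {\<zero>\<^bsub>M\<^esub>}"
  proof
    show "{x \<in> carrier M. h x = \<zero>\<^bsub>Q\<^esub>} \<subseteq> {\<zero>\<^bsub>M\<^esub>}"
    proof
      fix x assume "x \<in> {x \<in> carrier M. h x = \<zero>\<^bsub>Q\<^esub>}"
      then have "x \<in> carrier M" "h x = h \<zero>\<^bsub>M\<^esub>" by (simp_all add: zero)
      then show "x \<in> {\<zero>\<^bsub>M\<^esub>}" using bij inj_onD[of h "carrier M" x "\<zero>\<^bsub>M\<^esub>"] by (simp add: bij_betw_def)
    qed
  qed (simp add: zero)
  also have "{K \<in> submods R M. {\<zero>\<^bsub>M\<^esub>} \<subseteq> K} = submods R M"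
    using M.submods_zero by auto
  finally show ?thesis by simp
qed

lemma rmod_isomorphic_transversal:
  fixes M :: "('r, 'm) module"
  assumes "right_module R M" and "N \<in> submods R M"
  shows "\<exists>Q :: ('r, 'm) module. right_module R Q \<and> rmod_isomorphic R (factor_module M N) Q"
proof -
  interpret right_module R M by fact
  let ?F = "factor_module M N"
  interpret F: right_module R ?F by (rule right_module_factor_module[OF assms])
  have "carrier ?F = (\<lambda>x. N +>\<^bsub>M\<^esub> x) ` carrier M"
    by (auto simp: factor_module_def A_RCOSETS_def')
  \<comment> \<open>\<open>t\<close> picks a representative of each coset; \<open>Q\<close> is the factor module transported along \<open>t\<close>.\<close>
  then obtain t :: "'m set \<Rightarrow> 'm" where t: "inj_on t (carrier ?F)"
    by (metis inj_on_inv_into order_refl)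
  let ?s = "inv_into (carrier ?F) t"
  define Q :: "('r, 'm) module" where "Q = \<lparr>carrier = t ` carrier ?F, mult = undefined,
    one = undefined, zero = t \<zero>\<^bsub>?F\<^esub>, add = \<lambda>x y. t (?s x \<oplus>\<^bsub>?F\<^esub> ?s y),
    smult = \<lambda>r x. t (r \<odot>\<^bsub>?F\<^esub> ?s x)\<rparr>"
  have onto: "linear_onto R ?F Q t"
    using t by (simp add: linear_onto_def Q_def)
  have "rmod_isomorphic R ?F Q"
    unfolding rmod_isomorphic_def using onto t
    by (intro exI[of _ t]) (auto simp: linear_onto_def bij_betw_def)
  then show ?thesis using right_module_linear_onto[OF F.right_module_axioms onto] by blast
qed

text \<open>
  Since submodules of \<open>C (i+1)/C i\<close> correspond to the submodules between \<open>C i\<close> and \<open>C (i+1)\<close>,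
  the two recursions agree step by step.
\<close>

lemma has_ndim_iff_dev_le:
  fixes M :: "('r, 'm) module" and \<alpha> :: "'o::{wellorder, order_bot}"
  assumes "right_module R M"
  shows "has_ndim R M \<alpha> \<longleftrightarrow>
    dev_le (submods R M) \<alpha> \<and> (\<forall>\<beta><\<alpha>. \<not> dev_le (submods R M) \<beta>)"
  using assms
proof (induction \<alpha> arbitrary: M rule: less_induct)
  case (less \<alpha>)
  interpret right_module R M by fact
  have ex: "(\<exists>\<beta><\<alpha>. has_ndim R Q \<beta>) \<longleftrightarrow> (\<exists>\<beta><\<alpha>. dev_le (submods R Q) \<beta>)"
    if Q: "right_module R Q" for Q :: "('r, 'm) module"
  proof
    assume "\<exists>\<beta><\<alpha>. dev_le (submods R Q) \<beta>"
    then obtain \<beta> where \<beta>: "\<beta> < \<alpha>" "dev_le (submods R Q) \<beta>" by blast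
    let ?l = "LEAST \<gamma> :: 'o. dev_le (submods R Q) \<gamma>"
    have "?l < \<alpha>" using Least_le[of "\<lambda>\<gamma>. dev_le (submods R Q) \<gamma>", OF \<beta>(2)] \<beta>(1) by simp
    moreover have "dev_le (submods R Q) ?l" using LeastI[of "\<lambda>\<gamma>. dev_le (submods R Q) \<gamma>", OF \<beta>(2)] .
    moreover have "\<forall>\<gamma><?l. \<not> dev_le (submods R Q) \<gamma>" using not_less_Least by blast
    ultimately show "\<exists>\<beta><\<alpha>. has_ndim R Q \<beta>" using less.IH[OF _ Q] by blast
  qed (use less.IH[OF _ Q] in blast)
  show ?case
  proof (cases "\<alpha> = bot")
    case True
    have "carrier M = {\<zero>\<^bsub>M\<^esub>} \<longleftrightarrow> dev_le (submods R M) (bot :: 'o)"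
    proof
      assume "carrier M = {\<zero>\<^bsub>M\<^esub>}"
      then have "K = {\<zero>\<^bsub>M\<^esub>}" if "K \<in> submods R M" for K
        using submods_subset[OF that] submods_zero[OF that] by blast
      then have "\<not> K < L" if "K \<in> submods R M" "L \<in> submods R M" for K L
        using that by (metis order_less_irrefl)
      then show "dev_le (submods R M) (bot :: 'o)" unfolding dev_le_bot by blast
    next
      assume "dev_le (submods R M) (bot :: 'o)"
      then have "\<not> {\<zero>\<^bsub>M\<^esub>} \<subset> carrier M"
        using carrier_submods zero_submods by (simp add: dev_le_bot)
      then show "carrier M = {\<zero>\<^bsub>M\<^esub>}" using M.zero_closed by (simp add: psubset_eq)
    qed
    then show ?thesis using True by (subst has_ndim.simps) simp
  next
    case False
    have step: "(\<exists>\<beta>. \<beta> < \<alpha> \<and> (\<exists>Q :: ('r, 'm) module. right_module R Q \<and>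
          rmod_isomorphic R (factor_module (submod M L) K) Q \<and> has_ndim R Q \<beta>)) \<longleftrightarrow>
        (\<exists>\<beta><\<alpha>. dev_le {X \<in> submods R M. K \<le> X \<and> X \<le> L} \<beta>)"
      if KL: "K \<in> submods R M" "L \<in> submods R M" "K \<subseteq> L" for K L
    proof -
      have L: "right_module R (submod M L)"
        using right_module_submod[OF KL(2)] by (simp add: submod_def)
      have sL: "submods R (submod M L) = {X \<in> submods R M. X \<subseteq> L}"
        using submods_submod[OF KL(2)] by (simp add: submod_def)
      then have KL': "K \<in> submods R (submod M L)" using KL by auto
      note F = right_module_factor_module[OF L KL']
      have "{X \<in> submods R (submod M L). K \<subseteq> X} = {X \<in> submods R M. K \<le> X \<and> X \<le> L}"
        by (auto simp: sL)
      then have dev: "dev_le (submods R Q) \<beta> \<longleftrightarrow> dev_le {X \<in> submods R M. K \<le> X \<and> X \<le> L} \<beta>"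
        if "right_module R Q" "rmod_isomorphic R (factor_module (submod M L) K) Q"
        for Q :: "('r, 'm) module" and \<beta> :: 'o
        using dev_le_rmod_isomorphic[OF F that, of \<beta>] dev_le_factor_module[OF L KL', of \<beta>] by simp
      obtain Q :: "('r, 'm) module" where
        "right_module R Q" "rmod_isomorphic R (factor_module (submod M L) K) Q"
        using rmod_isomorphic_transversal[OF L KL'] by blast
      then show ?thesis using dev ex by (smt (verit))
    qed
    have "(\<exists>k. \<forall>i\<ge>k. \<exists>\<beta>. \<beta> < \<alpha> \<and> (\<exists>Q :: ('r, 'm) module. right_module R Q \<and>
             rmod_isomorphic R (factor_module (submod M (C (Suc i))) (C i)) Q \<and>
             has_ndim R Q \<beta>)) \<longleftrightarrow>
        (\<exists>k. \<forall>i\<ge>k. \<exists>\<beta><\<alpha>. dev_le {X \<in> submods R M. C i \<le> X \<and> X \<le> C (Suc i)} \<beta>)"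
      if "\<forall>i. C i \<in> submods R M" "\<forall>i. C i \<subseteq> C (Suc i)" for C
      using that step by (simp only: HOL.simp_thms)
    note steps = this
    have "(\<forall>C :: nat \<Rightarrow> 'm set. (\<forall>i. submodule (C i) R M) \<and> (\<forall>i. C i \<subseteq> C (Suc i)) \<longrightarrow>
         (\<exists>k. \<forall>i\<ge>k. \<exists>\<beta>. \<beta> < \<alpha> \<and> (\<exists>Q :: ('r, 'm) module. right_module R Q \<and>
             rmod_isomorphic R (factor_module (submod M (C (Suc i))) (C i)) Q \<and>
             has_ndim R Q \<beta>))) \<longleftrightarrow> dev_le (submods R M) \<alpha>"
      unfolding dev_le_nonbot[OF False]
    proof (rule all_cong1, rule imp_cong)
      fix C :: "nat \<Rightarrow> 'm set"
      show "(\<forall>i. submodule (C i) R M) \<and> (\<forall>i. C i \<subseteq> C (Suc i)) \<longleftrightarrow>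
          (\<forall>i. C i \<in> submods R M) \<and> (\<forall>i. C i \<le> C (Suc i))"
        by (simp only: submods_def mem_Collect_eq)
    next
      fix C :: "nat \<Rightarrow> 'm set"
      assume "(\<forall>i. C i \<in> submods R M) \<and> (\<forall>i. C i \<le> C (Suc i))"
      then show "(\<exists>k. \<forall>i\<ge>k. \<exists>\<beta>. \<beta> < \<alpha> \<and> (\<exists>Q :: ('r, 'm) module. right_module R Q \<and>
             rmod_isomorphic R (factor_module (submod M (C (Suc i))) (C i)) Q \<and>
             has_ndim R Q \<beta>)) \<longleftrightarrow>
          (\<exists>k. \<forall>i\<ge>k. \<exists>\<beta><\<alpha>. dev_le {X \<in> submods R M. C i \<le> X \<and> X \<le> C (Suc i)} \<beta>)"
        using steps by blast
    qed
    then show ?thesis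
      unfolding has_ndim.simps[of R M \<alpha>] using False ex[OF less.prems] by (simp add: conj_commute)
  qed
qed

lemma ndim_le_iff_dev_le:
  fixes M :: "('r, 'm) module" and \<alpha> :: "'o::{wellorder, order_bot}"
  assumes "right_module R M"
  shows "ndim_le R M \<alpha> \<longleftrightarrow> dev_le (submods R M) \<alpha>"
proof
  assume "ndim_le R M \<alpha>"
  then show "dev_le (submods R M) \<alpha>"
    unfolding ndim_le_def has_ndim_iff_dev_le[OF assms] by (blast intro: dev_le_mono)
next
  assume dev: "dev_le (submods R M) \<alpha>"
  let ?l = "LEAST \<beta> :: 'o. dev_le (submods R M) \<beta>"
  have "has_ndim R M ?l"
    using LeastI[of "\<lambda>\<beta> :: 'o. dev_le (submods R M) \<beta>", OF dev] not_less_Least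
    unfolding has_ndim_iff_dev_le[OF assms] by blast
  moreover have "?l \<le> \<alpha>" using dev by (rule Least_le)
  ultimately show "ndim_le R M \<alpha>" unfolding ndim_le_def by blast
qed

lemma has_ndim_submod_iff:
  fixes M :: "('r, 'm) module" and \<alpha> :: "'o::{wellorder, order_bot}"
  assumes "right_module R M" and "N \<in> submods R M"
  shows "has_ndim R (submod M N) \<alpha> \<longleftrightarrow> dev_le {K \<in> submods R M. K \<subseteq> N} \<alpha> \<and>
    (\<forall>\<beta><\<alpha>. \<not> dev_le {K \<in> submods R M. K \<subseteq> N} \<beta>)"
  unfolding submod_def has_ndim_iff_dev_le[OF right_module.right_module_submod[OF assms]]
    right_module.submods_submod[OF assms] ..

lemma ndim_le_submod_iff:
  fixes M :: "('r, 'm) module" and \<alpha> :: "'o::{wellorder, order_bot}"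
  assumes "right_module R M" and "N \<in> submods R M"
  shows "ndim_le R (submod M N) \<alpha> \<longleftrightarrow> dev_le {K \<in> submods R M. K \<subseteq> N} \<alpha>"
  unfolding submod_def ndim_le_iff_dev_le[OF right_module.right_module_submod[OF assms]]
    right_module.submods_submod[OF assms] ..

lemma ndim_le_factor_module_iff:
  fixes M :: "('r, 'm) module" and \<alpha> :: "'o::{wellorder, order_bot}"
  assumes "right_module R M" and "N \<in> submods R M"
  shows "ndim_le R (factor_module M N) \<alpha> \<longleftrightarrow> dev_le {K \<in> submods R M. N \<subseteq> K} \<alpha>"
  unfolding ndim_le_iff_dev_le[OF right_module_factor_module[OF assms]]
  by (rule dev_le_factor_module[OF assms])


section \<open>Descending families of submodules in AB5* modules\<close>

text \<open>
  It is AB5* together with the existence of some dimension \<open>\<gamma>\<close> of \<open>M\<close> itself that carries a bound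
  over to the intersection.  Suppose that
  \<open>C\<close> is a chain above \<open>\<Inter>\<A>\<close> witnessing that \<open>n-dim (M/\<Inter>\<A>) \<le> \<beta>\<close> fails.  If
  \<open>C n \<inter> A\<close> became stationary for some \<open>A\<close> in \<open>\<A>\<close>, late steps of \<open>C\<close> would embed into steps of
  the chain \<open>C n + A\<close>, against \<open>n-dim (M/A) \<le> \<beta>\<close>.  So \<open>C (n+1) \<inter> A\<close> is not inside \<open>C n\<close> for
  arbitrarily late \<open>n\<close>, and as \<open>C n\<close> is the intersection of all \<open>C n + A'\<close> by AB5*, it is not inside
  \<open>C n + A'\<close> for some \<open>A' \<subseteq> A\<close>.  Repeating this gives submodules \<open>X k = C (n\<^sub>k + 1) \<inter> A\<^sub>k\<close> and
  \<open>W k = C n\<^sub>k + A\<^sub>k\<^sub>+\<^sub>1\<close> such that \<open>X l \<subseteq> W k\<close> holds for \<open>l \<noteq> k\<close> but not for \<open>l = k\<close>.  Then distinct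
  sets of indices give distinct intersections of the \<open>W k\<close>, and the power set of \<open>\<nat>\<close> embeds into
  the lattice of submodules: \<open>M\<close> cannot have a dimension.
\<close>

lemma AB5_star_dev_le_Inter:
  fixes M :: "('r, 'm) module" and \<beta> \<gamma> :: "'o::{wellorder, order_bot}"
  assumes M: "right_module R M" and AB: "AB5_star R M" and dim: "dev_le (submods R M) \<gamma>"
    and ne: "\<A> \<noteq> {}" and sub: "\<A> \<subseteq> submods R M"
    and directed: "\<And>A A'. \<lbrakk>A \<in> \<A>; A' \<in> \<A>\<rbrakk> \<Longrightarrow> \<exists>A''\<in>\<A>. A'' \<subseteq> A \<inter> A'"
    and bound: "\<And>A. A \<in> \<A> \<Longrightarrow> dev_le {K \<in> submods R M. A \<subseteq> K} \<beta>"
  shows "dev_le {K \<in> submods R M. \<Inter>\<A> \<subseteq> K} \<beta>"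
proof (cases "\<beta> = bot")
  case True
  interpret right_module R M by fact
  have "A = carrier M" if A: "A \<in> \<A>" for A
  proof -
    have "A \<in> submods R M" using A sub by blast
    moreover from this have "A \<subseteq> carrier M" by (rule submods_subset)
    ultimately have "\<not> A < carrier M"
      using bound[OF A] carrier_submods unfolding True dev_le_bot by blast
    then show ?thesis using \<open>A \<subseteq> carrier M\<close> by blast
  qed
  then have "\<Inter>\<A> = carrier M" using ne by auto
  then have "K = carrier M" if "K \<in> {K \<in> submods R M. \<Inter>\<A> \<subseteq> K}" for K
    using that submods_subset by blast
  then show ?thesis unfolding True dev_le_bot by (metis order_less_irrefl)
next
  case False
  interpret right_module R M by fact
  show ?thesis
  proof (rule ccontr)
    assume "\<not> ?thesis"
    then have "\<exists>C. ((\<forall>i. C i \<in> {K \<in> submods R M. \<Inter>\<A> \<subseteq> K}) \<and> (\<forall>i. C i \<le> C (Suc i))) \<and>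
        \<not> (\<exists>k. \<forall>i\<ge>k. \<exists>\<delta><\<beta>.
          dev_le {x \<in> {K \<in> submods R M. \<Inter>\<A> \<subseteq> K}. C i \<le> x \<and> x \<le> C (Suc i)} \<delta>)"
      unfolding dev_le_nonbot[OF False] not_all not_imp .
    then obtain C :: "nat \<Rightarrow> 'm set" where
        "((\<forall>i. C i \<in> {K \<in> submods R M. \<Inter>\<A> \<subseteq> K}) \<and> (\<forall>i. C i \<le> C (Suc i))) \<and>
        \<not> (\<exists>k. \<forall>i\<ge>k. \<exists>\<delta><\<beta>.
          dev_le {x \<in> {K \<in> submods R M. \<Inter>\<A> \<subseteq> K}. C i \<le> x \<and> x \<le> C (Suc i)} \<delta>)" ..
    note CC = conjunct1[OF this] and fail = conjunct2[OF this]
    from CC have C: "\<And>i. C i \<in> submods R M" "\<And>i. \<Inter>\<A> \<subseteq> C i" "\<And>i. C i \<subseteq> C (Suc i)"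
      by simp_all
    have C_mono: "C i \<subseteq> C j" if "i \<le> j" for i j
      using that C(3) by (rule lift_Suc_mono_le[rotated])
    have "{x \<in> {K \<in> submods R M. \<Inter>\<A> \<subseteq> K}. C i \<le> x \<and> x \<le> C (Suc i)} =
        {K \<in> submods R M. C i \<subseteq> K \<and> K \<subseteq> C (Suc i)}" for i
      using C(2)[of i] by blast
    with fail have bad: "\<forall>k. \<exists>i\<ge>k. \<forall>\<delta><\<beta>.
        \<not> dev_le {K \<in> submods R M. C i \<subseteq> K \<and> K \<subseteq> C (Suc i)} \<delta>"
      by simp
    have grow: "\<exists>n\<ge>m. \<not> C (Suc n) \<inter> A \<subseteq> C n" if A: "A \<in> \<A>" for m A
    proof (rule ccontr)
      assume "\<not> ?thesis"
      then have stat: "C (Suc n) \<inter> A \<subseteq> C n" if "m \<le> n" for n using that by blast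
      have As: "A \<in> submods R M" using A sub by blast
      let ?D = "\<lambda>i. C i <+>\<^bsub>M\<^esub> A"
      have "(\<forall>i. ?D i \<in> {K \<in> submods R M. A \<subseteq> K}) \<and> (\<forall>i. ?D i \<le> ?D (Suc i))"
        using set_add_submods[OF C(1) As] set_add_upper(2)[OF C(1) As] set_add_mono[OF C(3)] by simp
      then obtain k where k: "\<forall>i\<ge>k. \<exists>\<delta><\<beta>.
          dev_le {x \<in> {K \<in> submods R M. A \<subseteq> K}. ?D i \<le> x \<and> x \<le> ?D (Suc i)} \<delta>"
        using bound[OF A, unfolded dev_le_nonbot[OF False], rule_format, of ?D] by blast
      obtain i where i: "max k m \<le> i"
        and nd: "\<forall>\<delta><\<beta>. \<not> dev_le {K \<in> submods R M. C i \<subseteq> K \<and> K \<subseteq> C (Suc i)} \<delta>"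
        using bad by blast
      obtain \<delta> where \<delta>: "\<delta> < \<beta>"
          "dev_le {x \<in> {K \<in> submods R M. A \<subseteq> K}. ?D i \<le> x \<and> x \<le> ?D (Suc i)} \<delta>"
        using k i by auto
      have "dev_le {K \<in> submods R M. C i \<subseteq> K \<and> K \<subseteq> C (Suc i)} \<delta>"
        using \<delta>(2)
      proof (rule dev_le_strict_mono[rotated 2])
        show "(\<lambda>K. K <+>\<^bsub>M\<^esub> A) ` {K \<in> submods R M. C i \<subseteq> K \<and> K \<subseteq> C (Suc i)} \<subseteq>
            {x \<in> {K \<in> submods R M. A \<subseteq> K}. ?D i \<le> x \<and> x \<le> ?D (Suc i)}"
          by (simp add: image_subset_iff set_add_submods As set_add_upper(2) set_add_mono)
        fix K L
        assume K: "K \<in> {K \<in> submods R M. C i \<subseteq> K \<and> K \<subseteq> C (Suc i)}"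
          and L: "L \<in> {K \<in> submods R M. C i \<subseteq> K \<and> K \<subseteq> C (Suc i)}" and KL: "K < L"
        have "L \<inter> A \<subseteq> K" using stat[of i] i K L by auto
        then have "\<not> L <+>\<^bsub>M\<^esub> A \<subseteq> K <+>\<^bsub>M\<^esub> A"
          using modular_collapse[of K L A] K L KL As by auto
        then show "K <+>\<^bsub>M\<^esub> A < L <+>\<^bsub>M\<^esub> A" using set_add_mono[of K L] KL by auto
      qed
      then show False using nd \<delta>(1) by blast
    qed
    have step: "\<exists>n>m. \<exists>A'\<in>\<A>. A' \<subseteq> A \<and> \<not> C (Suc n) \<inter> A \<subseteq> C n <+>\<^bsub>M\<^esub> A'" if A: "A \<in> \<A>" for m A
    proof -
      obtain n where n: "Suc m \<le> n" "\<not> C (Suc n) \<inter> A \<subseteq> C n" using grow[OF A] by blast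
      then obtain x where x: "x \<in> C (Suc n) \<inter> A" "x \<notin> C n" by blast
      have "C n <+>\<^bsub>M\<^esub> \<Inter>\<A> \<subseteq> C n"
      proof
        fix y assume "y \<in> C n <+>\<^bsub>M\<^esub> \<Inter>\<A>"
        then obtain c b where cb: "c \<in> C n" "b \<in> \<Inter>\<A>" "y = c \<oplus>\<^bsub>M\<^esub> b"
          unfolding mem_set_add by blast
        have "b \<in> C n" using C(2)[of n] cb(2) by (rule subsetD)
        then show "y \<in> C n" using submods_add[OF C(1) cb(1)] cb(3) by simp
      qed
      moreover have "C n <+>\<^bsub>M\<^esub> (\<Inter>A\<in>\<A>. A) = (\<Inter>A\<in>\<A>. C n <+>\<^bsub>M\<^esub> A)"
      proof -
        have "submodule (C n) R M" "\<forall>A\<in>\<A>. submodule A R M"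
          using C(1)[of n] sub by (auto simp: submods_def)
        moreover have "\<forall>A\<in>\<A>. \<forall>A'\<in>\<A>. \<exists>A''\<in>\<A>. A'' \<subseteq> A \<inter> A'" using directed by blast
        ultimately show ?thesis
          using AB[unfolded AB5_star_def, THEN spec[of _ "C n"], THEN spec[of _ \<A>]] ne by blast
      qed
      ultimately have "(\<Inter>A\<in>\<A>. C n <+>\<^bsub>M\<^esub> A) \<subseteq> C n" by simp
      then have "x \<notin> (\<Inter>A\<in>\<A>. C n <+>\<^bsub>M\<^esub> A)" using x(2) by (rule contra_subsetD)
      then obtain A' where A': "A' \<in> \<A>" "x \<notin> C n <+>\<^bsub>M\<^esub> A'" by blast
      then obtain A'' where A'': "A'' \<in> \<A>" "A'' \<subseteq> A \<inter> A'" using directed A by blast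
      then have "x \<notin> C n <+>\<^bsub>M\<^esub> A''" using A' by (auto simp: mem_set_add)
      then show ?thesis using n(1) x A'' by (intro exI[of _ n]) auto
    qed
    obtain A\<^sub>0 where A\<^sub>0: "A\<^sub>0 \<in> \<A>" using ne by blast
    have "\<exists>f :: nat \<Rightarrow> nat \<times> 'm set. \<forall>k. snd (f k) \<in> \<A> \<and> (snd (f (Suc k)) \<subseteq> snd (f k) \<and>
        fst (f k) < fst (f (Suc k)) \<and>
        \<not> C (Suc (fst (f (Suc k)))) \<inter> snd (f k) \<subseteq> C (fst (f (Suc k))) <+>\<^bsub>M\<^esub> snd (f (Suc k)))"
    proof (rule dependent_nat_choice)
      show "\<exists>x :: nat \<times> 'm set. snd x \<in> \<A>" using A\<^sub>0 by auto
      show "\<exists>y. snd y \<in> \<A> \<and> (snd y \<subseteq> snd x \<and> fst x < fst y \<and>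
          \<not> C (Suc (fst y)) \<inter> snd x \<subseteq> C (fst y) <+>\<^bsub>M\<^esub> snd y)" if "snd x \<in> \<A>" for x :: "nat \<times> 'm set"
        using step[OF that, of "fst x"] by auto
    qed
    then obtain f where f: "\<And>k. snd (f k) \<in> \<A>" "\<And>k. snd (f (Suc k)) \<subseteq> snd (f k)"
        "\<And>k. fst (f k) < fst (f (Suc k))"
        "\<And>k. \<not> C (Suc (fst (f (Suc k)))) \<inter> snd (f k) \<subseteq> C (fst (f (Suc k))) <+>\<^bsub>M\<^esub> snd (f (Suc k))"
      by blast
    define n where "n k = fst (f (Suc k))" for k
    define X where "X k = C (Suc (n k)) \<inter> snd (f k)" for k
    define W where "W k = C (n k) <+>\<^bsub>M\<^esub> snd (f (Suc k))" for k
    have n_less: "n k < n l" if "k < l" for k l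
      by (rule lift_Suc_mono_less[of n, OF _ that]) (simp add: n_def f(3))
    have A_anti: "snd (f l) \<subseteq> snd (f k)" if "k \<le> l" for k l
      using that by (rule lift_Suc_antimono_le[of "\<lambda>k. snd (f k)", OF f(2)])
    have fs: "snd (f k) \<in> submods R M" for k using f(1) sub by blast
    have Ws: "W k \<in> submods R M" for k unfolding W_def by (rule set_add_submods[OF C(1) fs])
    have X_diag: "\<not> X k \<subseteq> W k" for k using f(4) by (simp add: X_def W_def n_def)
    have X_off: "X l \<subseteq> W k" if "l \<noteq> k" for k l
    proof (cases "l < k")
      case True
      then have "Suc (n l) \<le> n k" using n_less by (simp add: Suc_le_eq)
      then have "X l \<subseteq> C (n k)" using C_mono unfolding X_def by blast
      then show ?thesis using set_add_upper(1)[OF C(1) fs] unfolding W_def by blast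
    next
      case False
      then have "Suc k \<le> l" using that by simp
      then have "X l \<subseteq> snd (f (Suc k))" using A_anti unfolding X_def by blast
      then show ?thesis using set_add_upper(2)[OF C(1) fs] unfolding W_def by blast
    qed
    define Y where "Y S = \<Inter>(insert (carrier M) (W ` (- S)))" for S
    have "dev_le (UNIV :: nat set set) \<gamma>"
      using dim
    proof (rule dev_le_strict_mono[rotated 2])
      show "range Y \<subseteq> submods R M"
      proof (rule image_subsetI)
        show "Y S \<in> submods R M" for S
          unfolding Y_def by (rule Inter_submods) (use Ws carrier_submods in auto)
      qed
      fix S T :: "nat set"
      assume "S < T"
      then obtain k where k: "k \<in> T" "k \<notin> S" and ST: "S \<subseteq> T" by blast
      have "X k \<subseteq> carrier M" using submods_subset[OF C(1)] by (auto simp: X_def)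
      moreover have "X k \<subseteq> W j" if "j \<in> - T" for j
        using that k(1) by (intro X_off) auto
      ultimately have "X k \<subseteq> Y T" unfolding Y_def by (intro Inter_greatest) blast
      moreover have "Y S \<subseteq> W k" using k(2) by (auto simp: Y_def)
      moreover have "Y S \<subseteq> Y T" using ST by (auto simp: Y_def)
      ultimately show "Y S < Y T" using X_diag[of k] by blast
    qed
    then show False using not_dev_le_Pow_nat by blast
  qed
qed

lemma AB5_star_minimal_submodule:
  fixes M :: "('r, 'm) module" and \<beta> \<gamma> :: "'o::{wellorder, order_bot}"
  assumes M: "right_module R M" and AB: "AB5_star R M" and dim: "dev_le (submods R M) \<gamma>"
  shows "\<exists>A\<in>submods R M. dev_le {K \<in> submods R M. A \<subseteq> K} \<beta> \<and>
    (\<forall>N\<in>submods R M. N \<subset> A \<longrightarrow> \<not> dev_le {K \<in> submods R M. N \<subseteq> K} \<beta>)"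
proof -
  interpret right_module R M by fact
  let ?F = "{A \<in> submods R M. dev_le {K \<in> submods R M. A \<subseteq> K} \<beta>}"
  have "{K \<in> submods R M. carrier M \<subseteq> K} = {carrier M}"
    using submods_subset carrier_submods by blast
  then have "dev_le {K \<in> submods R M. carrier M \<subseteq> K} (bot :: 'o)"
    unfolding dev_le_bot by simp
  then have "dev_le {K \<in> submods R M. carrier M \<subseteq> K} \<beta>" by (rule dev_le_mono) simp
  then have carrier: "carrier M \<in> ?F" using carrier_submods by simp
  have "\<exists>A\<in>?F. \<forall>N\<in>?F. N \<subseteq> A \<longrightarrow> N = A"
  proof (rule predicate_Zorn)
    show "partial_order_on ?F (relation_of (\<lambda>A N. N \<subseteq> A) ?F)"
      by (rule partial_order_on_relation_ofI) auto
    fix \<C> assume "\<C> \<in> Chains (relation_of (\<lambda>A N. N \<subseteq> A) ?F)"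
    then have chain: "\<C> \<subseteq> ?F" "\<And>A N. \<lbrakk>A \<in> \<C>; N \<in> \<C>\<rbrakk> \<Longrightarrow> A \<subseteq> N \<or> N \<subseteq> A"
      by (auto simp: Chains_def relation_of_def)
    show "\<exists>U\<in>?F. \<forall>A\<in>\<C>. U \<subseteq> A"
    proof (cases "\<C> = {}")
      case False
      have sub: "\<C> \<subseteq> submods R M" using chain(1) by blast
      have "dev_le {K \<in> submods R M. \<Inter>\<C> \<subseteq> K} \<beta>"
      proof (rule AB5_star_dev_le_Inter[OF M AB dim False sub])
        show "\<exists>A''\<in>\<C>. A'' \<subseteq> A \<inter> A'" if "A \<in> \<C>" "A' \<in> \<C>" for A A'
          using chain(2)[OF that] that by blast
      qed (use chain(1) in blast)
      then have "\<Inter>\<C> \<in> ?F" using Inter_submods[OF False sub] by blast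
      then show ?thesis by (intro bexI[of _ "\<Inter>\<C>"]) auto
    qed (use carrier in blast)
  qed
  then show ?thesis by blast
qed


section \<open>Short modules\<close>

lemma short_bound_iff_dev_le:
  fixes M :: "('r, 'm) module" and \<alpha> :: "'o::{wellorder, order_bot}"
  assumes "right_module R M"
  shows "short_bound R M \<alpha> \<longleftrightarrow> (\<forall>N\<in>submods R M.
    dev_le {K \<in> submods R M. K \<subseteq> N} \<alpha> \<or> dev_le {K \<in> submods R M. N \<subseteq> K} \<alpha>)"
  by (simp add: short_bound_def ndim_le_submod_iff[OF assms] ndim_le_factor_module_iff[OF assms]
      submods_def cong: imp_cong)

text \<open>
  If \<open>\<delta>\<close> bounds one side of every submodule, then a chain either stays among submodules of dimension
  at most \<open>\<delta>\<close>, or from some member on it lives in a factor module of dimension at most \<open>\<delta>\<close>.  In both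
  cases its late steps have dimension at most \<open>\<delta>\<close>, so \<open>n-dim M \<le> \<delta> + 1\<close>.
\<close>

lemma short_bound_imp_dev_le:
  fixes M :: "('r, 'm) module" and \<delta> \<gamma> :: "'o::{wellorder, order_bot}"
  assumes M: "right_module R M" and short: "short_bound R M \<delta>" and "\<delta> < \<gamma>"
  shows "dev_le (submods R M) \<gamma>"
proof -
  have nb: "\<gamma> \<noteq> bot" using \<open>\<delta> < \<gamma>\<close> by auto
  note short = short[unfolded short_bound_iff_dev_le[OF M], rule_format]
  show ?thesis unfolding dev_le_nonbot[OF nb]
  proof (intro allI impI)
    fix C :: "nat \<Rightarrow> 'm set"
    assume C: "(\<forall>i. C i \<in> submods R M) \<and> (\<forall>i. C i \<le> C (Suc i))"
    have "\<exists>k. \<forall>i\<ge>k. dev_le {K \<in> submods R M. C i \<le> K \<and> K \<le> C (Suc i)} \<delta>"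
    proof (cases "\<forall>i. dev_le {K \<in> submods R M. K \<subseteq> C i} \<delta>")
      case True
      have "dev_le {K \<in> submods R M. C i \<le> K \<and> K \<le> C (Suc i)} \<delta>" for i
        using True[rule_format, of "Suc i"] by (rule dev_le_subset) blast
      then show ?thesis by blast
    next
      case False
      then obtain k where "\<not> dev_le {K \<in> submods R M. K \<subseteq> C k} \<delta>" by blast
      then have k: "dev_le {K \<in> submods R M. C k \<subseteq> K} \<delta>" using short[of "C k"] C by blast
      have "dev_le {K \<in> submods R M. C i \<le> K \<and> K \<le> C (Suc i)} \<delta>" if "k \<le> i" for i
      proof -
        have "C k \<subseteq> C i" by (rule lift_Suc_mono_le[of C, OF _ that]) (use C in blast)
        then show ?thesis by (intro dev_le_subset[OF k]) blast
      qed
      then show ?thesis by blast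
    qed
    then show "\<exists>k. \<forall>i\<ge>k. \<exists>\<beta><\<gamma>. dev_le {K \<in> submods R M. C i \<le> K \<and> K \<le> C (Suc i)} \<beta>"
      using \<open>\<delta> < \<gamma>\<close> by blast
  qed
qed

text \<open>
  \<open>N/(N \<inter> A)\<close> embeds into \<open>M/A\<close>, so \<open>N\<close> is an extension of a module of dimension at most \<open>\<alpha>\<close> by
  another one.  For \<open>N = M\<close> this bounds \<open>n-dim M\<close> by the dimensions of \<open>A\<close> and \<open>M/A\<close>.
\<close>

lemma dev_le_submod_factor:
  fixes M :: "('r, 'm) module" and \<alpha> :: "'o::{wellorder, order_bot}"
  assumes M: "right_module R M" and N: "N \<in> submods R M" and A: "A \<in> submods R M"
    and "dev_le {K \<in> submods R M. K \<subseteq> N \<inter> A} \<alpha>"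
    and "dev_le {K \<in> submods R M. A \<subseteq> K} \<alpha>"
  shows "dev_le {K \<in> submods R M. K \<subseteq> N} \<alpha>"
proof (rule dev_le_pair[where f = "\<lambda>K. K \<inter> A" and g = "\<lambda>K. K <+>\<^bsub>M\<^esub> A", OF _ _ _ assms(4,5)])
  interpret right_module R M by fact
  show "(\<lambda>K. K \<inter> A) ` {K \<in> submods R M. K \<subseteq> N} \<subseteq> {K \<in> submods R M. K \<subseteq> N \<inter> A}"
    using Int_submods[OF _ A] by auto
  show "(\<lambda>K. K <+>\<^bsub>M\<^esub> A) ` {K \<in> submods R M. K \<subseteq> N} \<subseteq> {K \<in> submods R M. A \<subseteq> K}"
    using set_add_submods[OF _ A] set_add_upper(2)[OF _ A] by auto
  fix K L assume K: "K \<in> {K \<in> submods R M. K \<subseteq> N}" and L: "L \<in> {K \<in> submods R M. K \<subseteq> N}"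
    and KL: "K < L"
  have "K \<inter> A \<subseteq> L \<inter> A" "K <+>\<^bsub>M\<^esub> A \<subseteq> L <+>\<^bsub>M\<^esub> A" using KL set_add_mono[of K L] by auto
  moreover have "\<not> (L \<inter> A \<subseteq> K \<inter> A \<and> L <+>\<^bsub>M\<^esub> A \<subseteq> K <+>\<^bsub>M\<^esub> A)"
    using modular_collapse[of K L A] K L KL A by auto
  ultimately show "K \<inter> A \<le> L \<inter> A \<and> K <+>\<^bsub>M\<^esub> A \<le> L <+>\<^bsub>M\<^esub> A \<and>
      (K \<inter> A < L \<inter> A \<or> K <+>\<^bsub>M\<^esub> A < L <+>\<^bsub>M\<^esub> A)"
    by (simp add: less_le_not_le)
qed

theorem theorem3p20:
  fixes R :: "('r, 'x) ring_scheme" and M :: "('r, 'm) module"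
  assumes "right_module R M"
    and "AB5_star R M"
    and "\<exists>\<alpha> :: 'o::{wellorder, order_bot}. has_ndim R M \<alpha>"
  shows "M \<in> (\<Union>\<alpha> :: 'o. short_class R \<alpha>) \<longleftrightarrow>
    limit_ordinal (ndim R M :: 'o) \<or>
    (\<forall>A. submodule A R M \<and> (\<exists>\<alpha> :: 'o. atomic_module R (submod M A) \<alpha>) \<longrightarrow>
      (ndim R (submod M A) :: 'o) \<le> ndim R (factor_module M A))"
proof -
  interpret right_module R M by fact
  obtain \<alpha> :: 'o where \<alpha>: "has_ndim R M \<alpha>" using assms(3) by blast
  have dim: "dev_le (submods R M) \<alpha>" and least: "\<And>\<beta>. \<beta> < \<alpha> \<Longrightarrow> \<not> dev_le (submods R M) \<beta>"
    using \<alpha> unfolding has_ndim_iff_dev_le[OF assms(1)] by blast+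
  have ndim_M: "ndim R M = \<alpha>" by (rule ndim_eq[OF \<alpha>])
  let ?low = "\<lambda>A. {K \<in> submods R M. K \<subseteq> A}"
  let ?up = "\<lambda>A. {K \<in> submods R M. A \<subseteq> K}"
  note short_iff = short_bound_iff_dev_le[OF assms(1)]

  note sub_dim = has_ndim_submod_iff[OF assms(1)]
    and sub_le = ndim_le_submod_iff[OF assms(1)]
    and fac_le = ndim_le_factor_module_iff[OF assms(1)]
  have fac_ndim: "ndim R (factor_module M A) \<le> \<beta> \<longleftrightarrow> dev_le (?up A) \<beta>"
    if A: "A \<in> submods R M" for A and \<beta> :: 'o
  proof -
    have "dev_le (?up A) \<alpha>" by (rule dev_le_subset[OF dim]) blast
    then obtain \<delta> :: 'o where \<delta>: "has_ndim R (factor_module M A) \<delta>"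
      using fac_le[OF A] by (auto simp: ndim_le_def)
    have "ndim_le R (factor_module M A) \<beta> \<longleftrightarrow> \<delta> \<le> \<beta>"
      using \<delta> has_ndim_unique by (auto simp: ndim_le_def)
    then show ?thesis unfolding fac_le[OF A] ndim_eq[OF \<delta>] by simp
  qed
  have short_mono: "short_bound R M \<beta>" if "short_bound R M \<delta>" "\<delta> \<le> \<beta>" for \<beta> \<delta> :: 'o
    using that dev_le_mono unfolding short_iff by blast

  have "short_bound R M \<alpha>" unfolding short_iff using dev_le_subset[OF dim] by auto
  then have mem_iff: "M \<in> (\<Union>\<alpha> :: 'o. short_class R \<alpha>) \<longleftrightarrow> (\<forall>\<delta><\<alpha>. \<not> short_bound R M \<delta>)"
    using \<alpha> assms(1) has_ndim_unique[OF \<alpha>]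
    unfolding short_class_def short_module_def UN_iff mem_Collect_eq by blast

  show ?thesis
  proof (cases "limit_ordinal \<alpha>")
    case True
    have "\<not> short_bound R M \<delta>" if "\<delta> < \<alpha>" for \<delta>
      using that True short_bound_imp_dev_le[OF assms(1)] least
      unfolding limit_ordinal_def by blast
    then show ?thesis using mem_iff True ndim_M by blast
  next
    case not_limit: False
    show ?thesis
    proof (cases "\<alpha> = bot")
      case True
      have "\<not> atomic_module R (submod M A) \<gamma>" if A: "A \<in> submods R M" for A and \<gamma> :: 'o
      proof -
        have "\<not> {\<zero>\<^bsub>M\<^esub>} \<subset> A" using dim A zero_submods by (simp add: True dev_le_bot)
        then have "A = {\<zero>\<^bsub>M\<^esub>}" using submods_zero[OF A] by blast
        then show ?thesis by (simp add: atomic_module_def submod_def)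
      qed
      then show ?thesis using mem_iff True by (auto simp: submods_def)
    next
      case False
      \<comment> \<open>\<open>\<beta>\<close> is the predecessor of \<open>\<alpha>\<close>; it is \<open>bot\<close> if \<open>\<alpha>\<close> is the ordinal 0.\<close>
      obtain \<beta> where \<beta>: "\<beta> < \<alpha>" "\<And>\<gamma>. \<gamma> < \<alpha> \<Longrightarrow> \<gamma> \<le> \<beta>"
        using not_limit False unfolding limit_ordinal_def by (meson not_less)
      have mem_iff': "M \<in> (\<Union>\<alpha> :: 'o. short_class R \<alpha>) \<longleftrightarrow> \<not> short_bound R M \<beta>"
        using mem_iff \<beta> short_mono by blast
      have "short_bound R M \<beta> \<longleftrightarrow> (\<exists>A\<in>submods R M. (\<exists>\<gamma> :: 'o. atomic_module R (submod M A) \<gamma>) \<and>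
          \<not> (ndim R (submod M A) :: 'o) \<le> ndim R (factor_module M A))"
      proof
        assume short: "short_bound R M \<beta>"
        obtain A where A: "A \<in> submods R M" "dev_le (?up A) \<beta>"
          and min: "\<And>N. \<lbrakk>N \<in> submods R M; N \<subset> A\<rbrakk> \<Longrightarrow> \<not> dev_le (?up N) \<beta>"
          using AB5_star_minimal_submodule[OF assms(1,2) dim, of \<beta>] by (elim bexE conjE) simp
        \<comment> \<open>Otherwise \<open>A\<close> and \<open>M/A\<close> are both of dimension at most \<open>\<beta>\<close>, and so is \<open>M\<close>.\<close>
        have large: "\<not> dev_le (?low A) \<beta>"
        proof
          assume "dev_le (?low A) \<beta>"
          moreover have "carrier M \<inter> A = A" using submods_subset[OF A(1)] by blast
          ultimately have "dev_le (?low (carrier M)) \<beta>"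
            using dev_le_submod_factor[OF assms(1) carrier_submods A(1), of \<beta>] A(2) by simp
          moreover have "?low (carrier M) = submods R M" using submods_subset by blast
          ultimately show False using least[OF \<beta>(1)] by simp
        qed
        have dim_A: "has_ndim R (submod M A) \<alpha>"
          unfolding sub_dim[OF A(1)]
        proof (intro conjI allI impI)
          show "dev_le (?low A) \<alpha>" by (rule dev_le_subset[OF dim]) blast
          show "\<not> dev_le (?low A) \<delta>" if "\<delta> < \<alpha>" for \<delta>
            using large dev_le_mono \<beta>(2)[OF that] by blast
        qed
        have "ndim_less R (submod (submod M A) N) \<alpha>"
          if "submodule N R (submod M A)" "N \<noteq> carrier (submod M A)" for N
        proof -
          have N: "N \<in> submods R M" "N \<subset> A"
            using that submods_submod[OF A(1)] by (auto simp: submods_def submod_def)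
          then have "dev_le (?low N) \<beta>" using short min unfolding short_iff by blast
          then have "ndim_le R (submod M N) \<beta>" using sub_le[OF N(1)] by blast
          then have "ndim_less R (submod M N) \<alpha>"
            using \<beta>(1) order_le_less_trans unfolding ndim_le_def ndim_less_def by blast
          then show ?thesis by (simp add: submod_def)
        qed
        moreover have "A \<noteq> {\<zero>\<^bsub>M\<^esub>}"
        proof
          assume "A = {\<zero>\<^bsub>M\<^esub>}"
          then have "K = A" if "K \<in> ?low A" for K using that submods_zero by auto
          then have "dev_le (?low A) (bot :: 'o)" unfolding dev_le_bot by (metis order_less_irrefl)
          then show False using large dev_le_mono by (metis bot_least)
        qed
        ultimately have "atomic_module R (submod M A) \<alpha>"
          using dim_A by (simp add: atomic_module_def submod_def)
        moreover have "ndim R (factor_module M A) \<le> \<beta>" using fac_ndim[OF A(1)] A(2) by blast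
        then have "\<not> (ndim R (submod M A) :: 'o) \<le> ndim R (factor_module M A)"
          using ndim_eq[OF dim_A] \<beta>(1) by simp
        ultimately show "\<exists>A\<in>submods R M. (\<exists>\<gamma> :: 'o. atomic_module R (submod M A) \<gamma>) \<and>
          \<not> (ndim R (submod M A) :: 'o) \<le> ndim R (factor_module M A)"
          using A(1) by blast
      next
        assume "\<exists>A\<in>submods R M. (\<exists>\<gamma> :: 'o. atomic_module R (submod M A) \<gamma>) \<and>
          \<not> (ndim R (submod M A) :: 'o) \<le> ndim R (factor_module M A)"
        then obtain A and \<gamma> :: 'o where A: "A \<in> submods R M"
          and atomic: "atomic_module R (submod M A) \<gamma>"
          and "\<not> (ndim R (submod M A) :: 'o) \<le> ndim R (factor_module M A)" by blast
        then have less: "ndim R (factor_module M A) < \<gamma>"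
          using ndim_eq[of R "submod M A" \<gamma>] by (auto simp: atomic_module_def)
        have "dev_le (?low A) \<alpha>" by (rule dev_le_subset[OF dim]) blast
        then have "\<gamma> \<le> \<alpha>"
          using atomic sub_dim[OF A] by (auto simp: atomic_module_def not_less[symmetric])
        then have "ndim R (factor_module M A) \<le> \<beta>" using less \<beta>(2) by auto
        then have up_A: "dev_le (?up A) \<beta>" using fac_ndim[OF A] by blast
        show "short_bound R M \<beta>" unfolding short_iff
        proof
          fix N assume N: "N \<in> submods R M"
          show "dev_le (?low N) \<beta> \<or> dev_le (?up N) \<beta>"
          proof (cases "A \<subseteq> N")
            case True
            have "dev_le (?up N) \<beta>" using True by (intro dev_le_subset[OF up_A]) blast
            then show ?thesis ..
          next
            case False
            have NA: "N \<inter> A \<in> submods R M" using N A by (rule Int_submods)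
            then have "submodule (N \<inter> A) R (submod M A)"
              using submods_submod[OF A] by (auto simp: submods_def submod_def)
            moreover have "N \<inter> A \<noteq> carrier (submod M A)" using False by (auto simp: submod_def)
            ultimately have "ndim_less R (submod M (N \<inter> A)) \<gamma>"
              using atomic by (auto simp: atomic_module_def submod_def)
            then obtain \<delta> where \<delta>: "\<delta> < \<gamma>" "has_ndim R (submod M (N \<inter> A)) \<delta>"
              by (auto simp: ndim_less_def)
            then have "\<delta> \<le> \<beta>" using \<open>\<gamma> \<le> \<alpha>\<close> by (intro \<beta>(2)) simp
            then have "ndim_le R (submod M (N \<inter> A)) \<beta>"
              using \<delta>(2) unfolding ndim_le_def by blast
            then have "dev_le (?low (N \<inter> A)) \<beta>" using sub_le[OF NA] by blast
            then have "dev_le (?low N) \<beta>"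
              using up_A by (rule dev_le_submod_factor[OF assms(1) N A])
            then show ?thesis ..
          qed
        qed
      qed
      then show ?thesis using mem_iff' ndim_M not_limit by (auto simp: submods_def)
    qed
  qed
qed

end
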